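(* Let $k$ be an ordinary differential field of characteristic zero, let $P$ be a prime differential ideal of order $h$ in $k\{y_1,\ldots,y_l\}$, and let $>$ be any differential ranking (not necessarily orderly). Then there exists a characteristic set $\mathbb{C} = C_1,\ldots,C_n$ of the ideal $P$ with respect to the ranking $>$ such that for all $1\leq i\leq n$ and all $1\leq t\leq l$ the order of $C_i$ in $y_t$ does not exceed $h$.
   Context: Ordinary case: $\Delta=\{\delta\}$ consists of one derivation, and $\Theta=\{\delta^j : j\geq 0\}$. $k\{y_1,\ldots,y_l\}$ is the ring of differential polynomials, i.e. the polynomial ring over $k$ in the variables $\theta y_j$ ($\theta\in\Theta$, $1\le j\le l$), called differential variables. The order of $\delta^j y_t$ is $j$; $\operatorname{ord} f$ is the maximal order of a differential variable appearing effectively in $f$; the order of $f$ in $y_t$ is the maximal order of a derivative of $y_t$ appearing effectively in $f$ (if no derivative of $y_t$ appears, the bound is considered to hold). A ranking is a total order on the differential variables such that $\theta u\geq u$ and ($u\geq v\Rightarrow\theta u\geq\theta v$). It is orderly if $\operatorname{ord}u>\operatorname{ord}v$ implies $u>v$. Fix a ranking. The leader $u_f$ of $f\notin k$ is the highest differential variable appearing in $f$; if $d=\deg_{u_f}f$, the rank of $f$ is $u_f^d$. Ranks are compared by $u^{d}>v^{e}$ iff $u>v$, or $u=v$ and $d>e$. $f$ is reduced with respect to $g$ if no proper derivative of $u_g$ appears in $f$ and $\deg_{u_g}f<\deg_{u_g}g$. A set $\mathbb{A}\subset k\{y_1,\ldots,y_l\}\setminus k$ is autoreduced if each element is reduced with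 respect to all the others; such sets are finite and written $\mathbb{A}=A_1,\ldots,A_p$ in order of increasing rank. $\mathbb{A}=A_1,\ldots,A_r$ has lower rank than $\mathbb{B}=B_1,\ldots,B_s$ if there is $j\le r,s$ with $\operatorname{rank}A_i=\operatorname{rank}B_i$ for $i<j$ and $\operatorname{rank}A_j<\operatorname{rank}B_j$, or if $r>s$ and $\operatorname{rank}A_i=\operatorname{rank}B_i$ for $1\le i\le s$. A characteristic set of an ideal is an autoreduced subset of it of lowest rank. Order of a prime differential ideal $P$: $\operatorname{ord}P=\sum_i\operatorname{ord}D_i$, where $\mathbb{D}=D_1,\ldots,D_p$ is a characteristic set of $P$ with respect to an orderly ranking; this number does not depend on the choice of the orderly ranking or of $\mathbb{D}$. *)

theory Defs
  imports "HOL-Library.Poly_Mapping"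
begin

definition derivation :: "('a::comm_ring_1 \<Rightarrow> 'a) \<Rightarrow> bool" where
  "derivation d \<longleftrightarrow>
     (\<forall>a b. d (a + b) = d a + d b) \<and> (\<forall>a b. d (a * b) = d a * b + a * d b)"


section \<open>Ordinary differential polynomials\<close>

text \<open>The pair \<open>(t, j)\<close> stands for the differential variable \<open>\<delta>\<^sup>j y\<^sub>t\<close>. The
  differential indeterminates \<open>y\<^sub>1, \<dots>, y\<^sub>l\<close> are indexed by a finite type, whose
  cardinality is \<open>l\<close>. A monomial maps differential variables to exponents, and a polynomial
  maps monomials to coefficients.\<close>

type_synonym 'n dvar = "'n \<times> nat"
type_synonym 'n dmonom = "'n dvar \<Rightarrow>\<^sub>0 nat"
type_synonym ('n, 'k) dpoly = "'n dmonom \<Rightarrow>\<^sub>0 'k"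

definition theta :: "nat \<Rightarrow> 'n dvar \<Rightarrow> 'n dvar" where
  "theta i u = (fst u, snd u + i)"

abbreviation dconst :: "'k::zero \<Rightarrow> ('n, 'k) dpoly" where
  "dconst c \<equiv> Poly_Mapping.single 0 c"

abbreviation dvar_poly :: "'n dvar \<Rightarrow> ('n, 'k::zero_neq_one) dpoly" where
  "dvar_poly u \<equiv> Poly_Mapping.single (Poly_Mapping.single u 1) 1"

text \<open>The product rule on a term \<open>c m\<close>: one summand differentiates \<open>c\<close>, the others replace one
  factor \<open>u\<close> of \<open>m\<close> by its derivative.\<close>

definition dterm_deriv :: "('k \<Rightarrow> 'k) \<Rightarrow> 'n dmonom \<Rightarrow> 'k \<Rightarrow> ('n, 'k::comm_ring_1) dpoly" where
  "dterm_deriv \<delta> m c =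
     Poly_Mapping.single m (\<delta> c) +
     (\<Sum>u\<in>Poly_Mapping.keys m.
        Poly_Mapping.single (m - Poly_Mapping.single u 1 + Poly_Mapping.single (theta 1 u) 1)
          (of_nat (Poly_Mapping.lookup m u) * c))"

definition dpoly_deriv :: "('k \<Rightarrow> 'k) \<Rightarrow> ('n, 'k::comm_ring_1) dpoly \<Rightarrow> ('n, 'k) dpoly" where
  "dpoly_deriv \<delta> f = (\<Sum>m\<in>Poly_Mapping.keys f. dterm_deriv \<delta> m (Poly_Mapping.lookup f m))"

definition dvars :: "('n, 'k::zero) dpoly \<Rightarrow> 'n dvar set" where
  "dvars f = (\<Union>m\<in>Poly_Mapping.keys f. Poly_Mapping.keys m)"

definition deg_in :: "'n dvar \<Rightarrow> ('n, 'k::zero) dpoly \<Rightarrow> nat" where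
  "deg_in u f = Max (insert 0 ((\<lambda>m. Poly_Mapping.lookup m u) ` Poly_Mapping.keys f))"

text \<open>The next two are meant only where the maximum is over a nonempty set, i.e. for
  \<open>f\<close> outside the coefficient field, resp. for \<open>f\<close> involving some derivative of \<open>y\<^sub>t\<close>.\<close>

definition dord :: "('n, 'k::zero) dpoly \<Rightarrow> nat" where
  "dord f = Max (snd ` dvars f)"

definition dord_in :: "'n \<Rightarrow> ('n, 'k::zero) dpoly \<Rightarrow> nat" where
  "dord_in t f = Max {j. (t, j) \<in> dvars f}"

definition prime_diff_ideal :: "('k \<Rightarrow> 'k) \<Rightarrow> ('n, 'k::field) dpoly set \<Rightarrow> bool" where
  "prime_diff_ideal \<delta> P \<longleftrightarrow>
     0 \<in> P \<and> (\<forall>f\<in>P. \<forall>g\<in>P. f + g \<in> P) \<and> (\<forall>f. \<forall>g\<in>P. f * g \<in> P) \<and>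
     (\<forall>f\<in>P. dpoly_deriv \<delta> f \<in> P) \<and>
     1 \<notin> P \<and> (\<forall>f g. f * g \<in> P \<longrightarrow> f \<in> P \<or> g \<in> P)"


section \<open>Rankings and characteristic sets\<close>

text \<open>In a ranking \<open>r\<close>, membership \<open>(u, v) \<in> r\<close> means \<open>u \<le> v\<close>.\<close>

definition ranking :: "'n dvar rel \<Rightarrow> bool" where
  "ranking r \<longleftrightarrow> linear_order r \<and> (\<forall>u i. (u, theta i u) \<in> r) \<and>
     (\<forall>u v i. (v, u) \<in> r \<longrightarrow> (theta i v, theta i u) \<in> r)"

definition orderly :: "'n dvar rel \<Rightarrow> bool" where
  "orderly r \<longleftrightarrow> (\<forall>u v. snd u > snd v \<longrightarrow> (v, u) \<in> r \<and> v \<noteq> u)"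

definition leader :: "'n dvar rel \<Rightarrow> ('n, 'k::zero) dpoly \<Rightarrow> 'n dvar" where
  "leader r f = (THE u. u \<in> dvars f \<and> (\<forall>v\<in>dvars f. (v, u) \<in> r))"

definition rank :: "'n dvar rel \<Rightarrow> ('n, 'k::zero) dpoly \<Rightarrow> 'n dvar \<times> nat" where
  "rank r f = (leader r f, deg_in (leader r f) f)"

definition rank_less :: "'n dvar rel \<Rightarrow> 'n dvar \<times> nat \<Rightarrow> 'n dvar \<times> nat \<Rightarrow> bool" where
  "rank_less r a b \<longleftrightarrow>
     (fst a, fst b) \<in> r \<and> fst a \<noteq> fst b \<or> fst a = fst b \<and> snd a < snd b"

definition reduced_wrt :: "'n dvar rel \<Rightarrow> ('n, 'k::zero) dpoly \<Rightarrow> ('n, 'k) dpoly \<Rightarrow> bool" where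
  "reduced_wrt r f g \<longleftrightarrow>
     (\<forall>i>0. theta i (leader r g) \<notin> dvars f) \<and>
     deg_in (leader r g) f < deg_in (leader r g) g"

definition autoreduced :: "'n dvar rel \<Rightarrow> ('n, 'k::zero) dpoly set \<Rightarrow> bool" where
  "autoreduced r A \<longleftrightarrow> A \<inter> range dconst = {} \<and>
     (\<forall>f\<in>A. \<forall>g\<in>A. f \<noteq> g \<longrightarrow> reduced_wrt r f g)"

text \<open>The list of the elements of an autoreduced set in order of increasing rank. Every autoreduced
  set has exactly one such list: it is finite (\<open>autoreduced_finite\<close> below), and distinct elements
  have distinct leaders.\<close>

definition autoreduced_seq :: "'n dvar rel \<Rightarrow> ('n, 'k::zero) dpoly list \<Rightarrow> bool" where
  "autoreduced_seq r A \<longleftrightarrow>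
     autoreduced r (set A) \<and> sorted_wrt (\<lambda>f g. rank_less r (rank r f) (rank r g)) A"

definition lower_rank ::
  "'n dvar rel \<Rightarrow> ('n, 'k::zero) dpoly list \<Rightarrow> ('n, 'k) dpoly list \<Rightarrow> bool" where
  "lower_rank r A B \<longleftrightarrow>
     (\<exists>j. j < length A \<and> j < length B \<and>
        (\<forall>i<j. rank r (A ! i) = rank r (B ! i)) \<and>
        rank_less r (rank r (A ! j)) (rank r (B ! j))) \<or>
     length A > length B \<and> (\<forall>i<length B. rank r (A ! i) = rank r (B ! i))"

definition characteristic_set ::
  "'n dvar rel \<Rightarrow> ('n, 'k::zero) dpoly set \<Rightarrow> ('n, 'k) dpoly list \<Rightarrow> bool" where
  "characteristic_set r I C \<longleftrightarrow> autoreduced_seq r C \<and> set C \<subseteq> I \<and>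
     (\<forall>B. autoreduced_seq r B \<and> set B \<subseteq> I \<longrightarrow> \<not> lower_rank r B C)"

text \<open>For a prime differential ideal there is exactly one such \<open>h\<close>, since the sum does not depend on
  the choice of \<open>r\<close> and \<open>D\<close>.\<close>

definition has_order :: "('n, 'k::zero) dpoly set \<Rightarrow> nat \<Rightarrow> bool" where
  "has_order P h \<longleftrightarrow>
     (\<exists>r D. ranking r \<and> orderly r \<and> characteristic_set r P D \<and> h = (\<Sum>f\<leftarrow>D. dord f))"


section \<open>Basic facts\<close>

lemma dterm_deriv_add:
  assumes "derivation \<delta>"
  shows "dterm_deriv \<delta> m (c + c') = dterm_deriv \<delta> m c + dterm_deriv \<delta> m c'"
  using assms by (simp add: dterm_deriv_def derivation_def single_add sum.distrib algebra_simps)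

lemma dterm_deriv_0:
  assumes "derivation \<delta>"
  shows "dterm_deriv \<delta> m 0 = 0"
  using dterm_deriv_add[OF assms, of m 0 0] by simp

lemma dpoly_deriv_superset:
  assumes "derivation \<delta>" "finite S" "Poly_Mapping.keys f \<subseteq> S"
  shows "dpoly_deriv \<delta> f = (\<Sum>m\<in>S. dterm_deriv \<delta> m (Poly_Mapping.lookup f m))"
  unfolding dpoly_deriv_def
  by (rule sum.mono_neutral_left) (use assms in \<open>auto simp: dterm_deriv_0 in_keys_iff\<close>)

lemma dpoly_deriv_add:
  assumes "derivation \<delta>"
  shows "dpoly_deriv \<delta> (f + g) = dpoly_deriv \<delta> f + dpoly_deriv \<delta> g"
proof -
  let ?S = "Poly_Mapping.keys f \<union> Poly_Mapping.keys g"
  show ?thesis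
    by (simp add: dpoly_deriv_superset[OF assms, of ?S] keys_add lookup_add
        dterm_deriv_add[OF assms] sum.distrib)
qed

lemma dpoly_deriv_single:
  assumes "derivation \<delta>"
  shows "dpoly_deriv \<delta> (Poly_Mapping.single m c) = dterm_deriv \<delta> m c"
  by (simp add: dpoly_deriv_superset[OF assms, of "{m}"])

lemma dpoly_deriv_dconst:
  assumes "derivation \<delta>"
  shows "dpoly_deriv \<delta> (dconst c) = dconst (\<delta> c)"
  by (simp add: dpoly_deriv_single[OF assms] dterm_deriv_def)

lemma dpoly_deriv_dvar_poly:
  assumes "derivation \<delta>"
  shows "dpoly_deriv \<delta> (dvar_poly u) = dvar_poly (theta 1 u)"
proof -
  have "\<delta> 1 = \<delta> 1 + \<delta> 1"
    using assms unfolding derivation_def by (metis mult_1 mult_1_right)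
  then show ?thesis by (simp add: dpoly_deriv_single[OF assms] dterm_deriv_def)
qed

lemma dterm_deriv_superset:
  assumes "finite S" "Poly_Mapping.keys m \<subseteq> S"
  shows "dterm_deriv \<delta> m c = Poly_Mapping.single m (\<delta> c) +
     (\<Sum>u\<in>S. Poly_Mapping.single (m - Poly_Mapping.single u 1 + Poly_Mapping.single (theta 1 u) 1)
          (of_nat (Poly_Mapping.lookup m u) * c))"
  unfolding dterm_deriv_def
  by (intro arg_cong2[where f = plus] refl sum.mono_neutral_left)
    (use assms in \<open>auto simp: in_keys_iff\<close>)

lemma monom_diff_add:
  fixes m m' :: "'n dmonom"
  assumes "Poly_Mapping.lookup m u \<noteq> 0"
  shows "m + m' - Poly_Mapping.single u 1 = m - Poly_Mapping.single u 1 + m'"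
  by (rule poly_mapping_eqI)
    (use assms in \<open>auto simp: lookup_add lookup_minus lookup_single when_def\<close>)

lemma dterm_deriv_mult:
  assumes "derivation \<delta>"
  shows "dterm_deriv \<delta> (m + m') (c * c') =
    dterm_deriv \<delta> m c * Poly_Mapping.single m' c' + Poly_Mapping.single m c * dterm_deriv \<delta> m' c'"
proof -
  let ?S = "Poly_Mapping.keys m \<union> Poly_Mapping.keys m'"
  let ?e = "\<lambda>m u. m - Poly_Mapping.single u 1 + Poly_Mapping.single (theta 1 u) 1"
  let ?l = Poly_Mapping.lookup
  have e: "Poly_Mapping.single (?e (m + m') u) (of_nat (?l m u) * x) =
      Poly_Mapping.single (?e m u + m') (of_nat (?l m u) * x)" for m m' u and x :: 'a
  proof (cases "?l m u = 0")
    case False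
    then show ?thesis by (subst monom_diff_add) (simp_all add: add_ac)
  qed simp
  have *: "Poly_Mapping.single (?e (m + m') u) (of_nat (?l (m + m') u) * (c * c')) =
      Poly_Mapping.single (?e m u) (of_nat (?l m u) * c) * Poly_Mapping.single m' c' +
      Poly_Mapping.single m c * Poly_Mapping.single (?e m' u) (of_nat (?l m' u) * c')" for u
    using e[of m m' u "c * c'"] e[of m' m u "c * c'"]
    by (simp add: lookup_add mult_single distrib_left distrib_right single_add add_ac mult_ac)
  have d: "\<delta> (c * c') = \<delta> c * c' + c * \<delta> c'"
    using assms by (simp add: derivation_def)
  have "dterm_deriv \<delta> (m + m') (c * c') = Poly_Mapping.single (m + m') (\<delta> (c * c')) +
     (\<Sum>u\<in>?S. Poly_Mapping.single (?e (m + m') u) (of_nat (?l (m + m') u) * (c * c')))"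
    by (rule dterm_deriv_superset) (simp_all add: keys_add)
  also have "\<dots> = (Poly_Mapping.single m (\<delta> c) +
        (\<Sum>u\<in>?S. Poly_Mapping.single (?e m u) (of_nat (?l m u) * c))) * Poly_Mapping.single m' c' +
      Poly_Mapping.single m c * (Poly_Mapping.single m' (\<delta> c') +
        (\<Sum>u\<in>?S. Poly_Mapping.single (?e m' u) (of_nat (?l m' u) * c')))"
    unfolding * d
    by (simp add: sum.distrib sum_distrib_left sum_distrib_right distrib_left distrib_right
        mult_single single_add add_ac)
  also have "\<dots> = dterm_deriv \<delta> m c * Poly_Mapping.single m' c' +
      Poly_Mapping.single m c * dterm_deriv \<delta> m' c'"
    by (simp add: dterm_deriv_superset[of ?S])
  finally show ?thesis .
qed

lemma sum_single_keys:
  "(\<Sum>m\<in>Poly_Mapping.keys f. Poly_Mapping.single m (Poly_Mapping.lookup f m)) = f"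
  by (rule poly_mapping_eqI)
    (auto simp: lookup_sum lookup_single when_def sum.delta' in_keys_iff)

lemma dpoly_deriv_sum:
  assumes "derivation \<delta>"
  shows "dpoly_deriv \<delta> (sum f S) = (\<Sum>x\<in>S. dpoly_deriv \<delta> (f x))"
proof (induction S rule: infinite_finite_induct)
  case (insert x F)
  then show ?case by (simp add: dpoly_deriv_add[OF assms])
qed (simp_all add: dpoly_deriv_def)

text \<open>The three facts \<open>dpoly_deriv_dconst\<close>, \<open>dpoly_deriv_dvar_poly\<close> and \<open>derivation_dpoly_deriv\<close>
  characterize the derivation of the ring of differential polynomials.\<close>

lemma derivation_dpoly_deriv:
  fixes \<delta> :: "'a::comm_ring_1 \<Rightarrow> 'a"
  assumes "derivation \<delta>"
  shows "derivation (dpoly_deriv \<delta> :: ('n, 'a) dpoly \<Rightarrow> _)"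
proof -
  have "dpoly_deriv \<delta> (f * g) = dpoly_deriv \<delta> f * g + f * dpoly_deriv \<delta> g"
    for f g :: "('n, 'a) dpoly"
  proof -
    let ?s = "\<lambda>f m. Poly_Mapping.single m (Poly_Mapping.lookup f m)"
    let ?F = "Poly_Mapping.keys f" and ?G = "Poly_Mapping.keys g"
    have "dpoly_deriv \<delta> ((\<Sum>m\<in>?F. ?s f m) * (\<Sum>m\<in>?G. ?s g m)) =
      (\<Sum>m\<in>?F. \<Sum>m'\<in>?G. dpoly_deriv \<delta> (?s f m) * ?s g m' + ?s f m * dpoly_deriv \<delta> (?s g m'))"
      by (simp add: sum_product dpoly_deriv_sum[OF assms] mult_single
          dpoly_deriv_single[OF assms] dterm_deriv_mult[OF assms])
    also have "\<dots> = dpoly_deriv \<delta> (\<Sum>m\<in>?F. ?s f m) * (\<Sum>m\<in>?G. ?s g m) +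
        (\<Sum>m\<in>?F. ?s f m) * dpoly_deriv \<delta> (\<Sum>m\<in>?G. ?s g m)"
      by (simp add: sum_product dpoly_deriv_sum[OF assms] sum.distrib)
    finally show ?thesis by (simp only: sum_single_keys)
  qed
  then show ?thesis by (simp add: derivation_def dpoly_deriv_add[OF assms])
qed

lemma finite_dvars: "finite (dvars f)"
  by (simp add: dvars_def)

lemma dvars_eq_empty_iff: "dvars f = {} \<longleftrightarrow> f \<in> range dconst"
proof
  assume "dvars f = {}"
  then have "Poly_Mapping.keys m = {}" if "m \<in> Poly_Mapping.keys f" for m
    using that by (auto simp: dvars_def)
  then have k: "m = 0" if "m \<in> Poly_Mapping.keys f" for m
    using that by (metis empty_iff in_keys_iff lookup_zero poly_mapping_eqI)
  have "f = dconst (Poly_Mapping.lookup f 0)"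
    by (rule poly_mapping_eqI) (metis in_keys_iff k lookup_single_eq lookup_single_not_eq)
  then show "f \<in> range dconst" by blast
qed (auto simp: dvars_def split: if_splits)

lemma leader_greatest:
  assumes "ranking r" "f \<notin> range dconst"
  shows "leader r f \<in> dvars f \<and> (\<forall>v\<in>dvars f. (v, leader r f) \<in> r)"
proof -
  have lin: "refl r" "trans r" "antisym r" "total r"
    using assms(1)
    by (auto simp: ranking_def linear_order_on_def partial_order_on_def preorder_on_def)
  have tot: "(u, v) \<in> r \<or> (v, u) \<in> r" for u v
    using lin by (metis UNIV_I refl_onD total_on_def)
  have "\<exists>u\<in>S. \<forall>v\<in>S. (v, u) \<in> r" if "finite S" "S \<noteq> {}" for S
    using that
  proof (induction S rule: finite_ne_induct)
    case (singleton x)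
    then show ?case using tot by blast
  next
    case (insert x F)
    then obtain u where "u \<in> F" "\<forall>v\<in>F. (v, u) \<in> r" by blast
    then show ?case using tot[of u x] tot[of x x] lin(2) by (metis insert_iff transD)
  qed
  then have "\<exists>!u. u \<in> dvars f \<and> (\<forall>v\<in>dvars f. (v, u) \<in> r)"
    using finite_dvars[of f] dvars_eq_empty_iff[of f] assms(2) lin(3) by (meson antisymD)
  then show ?thesis unfolding leader_def by (rule theI')
qed

lemma autoreduced_finite:
  fixes A :: "('n::finite, 'k::zero) dpoly set"
  assumes "ranking r" "autoreduced r A"
  shows "finite A"
proof (rule finite_imageD)
  show "finite ((\<lambda>f. fst (leader r f)) ` A)" by simp
  have *: "f = g" if "f \<in> A" "g \<in> A" "fst (leader r f) = fst (leader r g)"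
    "snd (leader r g) \<le> snd (leader r f)" for f g
  proof (rule ccontr)
    assume "f \<noteq> g"
    then have red: "reduced_wrt r f g" "reduced_wrt r g f"
      using assms(2) that by (auto simp: autoreduced_def)
    have "leader r f \<in> dvars f"
      using leader_greatest[OF assms(1)] assms(2) that(1) by (auto simp: autoreduced_def)
    moreover have "leader r f = theta (snd (leader r f) - snd (leader r g)) (leader r g)"
      using that(3,4) by (simp add: theta_def prod_eq_iff)
    ultimately have "snd (leader r f) = snd (leader r g)"
      using red(1) that(4) unfolding reduced_wrt_def by (metis le_neq_implies_less zero_less_diff)
    then have "leader r f = leader r g" using that(3) by (simp add: prod_eq_iff)
    then show False using red by (auto simp: reduced_wrt_def)
  qed
  show "inj_on (\<lambda>f. fst (leader r f)) A"
    by (rule inj_onI) (metis * nle_le)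
qed

end

theory Submission
  imports Defs "HOL-Library.FuncSet" "HOL.Vector_Spaces"
begin

text \<open>
  Work with algebraic dependence of the differential variables modulo \<open>P\<close>. For a characteristic set
  the variables that are not derivatives of a leader form a transcendence basis. For the orderly
  ranking this basis shows that the variables of order \<open>\<le> s\<close> have transcendence degree
  \<open>(l - p) (s + 1) + h\<close> for large \<open>s\<close>, where \<open>p\<close> is the number of leaders. Comparison with the basis
  belonging to the given ranking shows that the orders of its leaders add up to at most \<open>h\<close>.

  Every leader \<open>u\<close> of the given ranking satisfies a relation \<open>F u\<close> of minimal degree over smaller
  basis variables. If some \<open>F u\<close> had order \<open>a > h\<close> in a basis variable \<open>z\<close>, with \<open>a\<close> maximal among
  all \<open>u\<close>, then the derivatives of \<open>F u\<close> would express those of \<open>z\<close>, of order above \<open>a\<close>, through those of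
  \<open>u\<close>, of order at most \<open>a\<close>, and the transcendence degree above would be exceeded. Hence every leader
  is algebraic over basis variables of order \<open>\<le> h\<close>. It follows that the basis variables
  of order \<open>> h\<close> are independent of everything else that occurs in a characteristic set, so that the
  coefficients of its elements with respect to these variables lie in \<open>P\<close>; suitable coefficients form the
  required characteristic set.
\<close>

abbreviation (input) "keys \<equiv> Poly_Mapping.keys"
abbreviation (input) "lookup \<equiv> Poly_Mapping.lookup"
abbreviation (input) "single \<equiv> Poly_Mapping.single"

section \<open>Polynomials: variables, degrees and coefficients\<close>

lemma dpoly_induct [case_names zero add]:
  assumes "P 0" and "\<And>m c f. P f \<Longrightarrow> P (single m c + f)"
  shows "P (f :: ('n, 'k::comm_monoid_add) dpoly)"
proof -
  have "P (\<Sum>m\<in>S. single m (lookup f m))" if "finite S" for S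
    using that by (induction S rule: finite_induct) (simp_all add: assms)
  from this[OF finite_keys[of f]] show ?thesis by (simp add: sum_single_keys)
qed

lemma dvars_zero [simp]: "dvars 0 = {}"
  and dvars_one [simp]: "dvars 1 = {}"
  by (simp_all add: dvars_def)

lemma dvars_single: "dvars (single m c) = (if c = 0 then {} else keys m)"
  by (simp add: dvars_def)

lemma dvars_add: "dvars f \<subseteq> A \<Longrightarrow> dvars g \<subseteq> A \<Longrightarrow> dvars (f + g) \<subseteq> A"
  using keys_add[of f g] unfolding dvars_def by blast

lemma dvars_uminus [simp]: "dvars (- f :: ('n, 'k::ab_group_add) dpoly) = dvars f"
  by (auto simp: dvars_def in_keys_iff)

lemma dvars_diff:
  "dvars f \<subseteq> A \<Longrightarrow> dvars g \<subseteq> A \<Longrightarrow> dvars (f - g :: ('n, 'k::ab_group_add) dpoly) \<subseteq> A"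
  using dvars_add[of f A "- g"] by simp

lemma dvars_mult:
  assumes "dvars f \<subseteq> A" "dvars g \<subseteq> A"
  shows "dvars (f * g) \<subseteq> A"
proof
  fix v assume "v \<in> dvars (f * g)"
  then obtain a b where "a \<in> keys f" "b \<in> keys g" "v \<in> keys (a + b)"
    using keys_mult[of f g] unfolding dvars_def by blast
  then show "v \<in> A" using keys_add[of a b] assms unfolding dvars_def by blast
qed

lemma dvars_sum: "(\<And>i. i \<in> I \<Longrightarrow> dvars (f i) \<subseteq> A) \<Longrightarrow> dvars (sum f I) \<subseteq> A"
  by (induction I rule: infinite_finite_induct) (simp_all add: dvars_add)

lemma dvars_power:
  fixes f :: "('n, 'k::comm_semiring_1) dpoly"
  shows "dvars f \<subseteq> A \<Longrightarrow> dvars (f ^ n) \<subseteq> A"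
  by (induction n) (simp_all add: dvars_mult)

section \<open>Total degrees of monomials and degree bounds\<close>

definition tdeg :: "'n dmonom \<Rightarrow> nat" where
  "tdeg m = (\<Sum>v\<in>keys m. lookup m v)"

lemma tdeg_superset: "finite S \<Longrightarrow> keys m \<subseteq> S \<Longrightarrow> tdeg m = (\<Sum>v\<in>S. lookup m v)"
  unfolding tdeg_def by (rule sum.mono_neutral_left) (auto simp: in_keys_iff)

lemma tdeg_add: "tdeg (m + m') = tdeg m + tdeg m'"
  by (simp add: tdeg_superset[of "keys m \<union> keys m'"] keys_add lookup_add sum.distrib)

lemma tdeg_single [simp]: "tdeg (single v j) = j"
  by (simp add: tdeg_def)

lemma tdeg_zero [simp]: "tdeg 0 = 0"
  by (simp add: tdeg_def)

lemma lookup_le_tdeg: "lookup m v \<le> tdeg m"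
  by (cases "v \<in> keys m") (simp_all add: tdeg_def in_keys_iff member_le_sum)

text \<open>A bound instead of a degree: the zero polynomial satisfies every bound, and no maximum
  over an empty set arises.\<close>

definition degle :: "nat \<Rightarrow> ('n, 'k::zero) dpoly \<Rightarrow> bool" where
  "degle N f \<longleftrightarrow> (\<forall>m\<in>keys f. tdeg m \<le> N)"

lemma degle_zero [simp]: "degle N 0"
  by (simp add: degle_def)

lemma degle_one [simp]: "degle N (1 :: ('n, 'k::zero_neq_one) dpoly)"
  by (simp add: degle_def)

lemma degle_single: "tdeg m \<le> N \<Longrightarrow> degle N (single m c)"
  by (simp add: degle_def)

lemma degle_mono: "degle N f \<Longrightarrow> N \<le> M \<Longrightarrow> degle M f"
  by (auto simp: degle_def)

lemma degle_exists: "\<exists>N. degle N f"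
proof
  show "degle (\<Sum>m\<in>keys f. tdeg m) f" by (simp add: degle_def member_le_sum)
qed

lemma degle_add: "degle N f \<Longrightarrow> degle N g \<Longrightarrow> degle N (f + g)"
  using keys_add[of f g] unfolding degle_def by blast

lemma degle_diff: "degle N f \<Longrightarrow> degle N g \<Longrightarrow> degle N (f - g :: ('n, 'k::ab_group_add) dpoly)"
  using keys_diff[of f g] unfolding degle_def by blast

lemma degle_sum: "(\<And>i. i \<in> I \<Longrightarrow> degle N (f i)) \<Longrightarrow> degle N (sum f I)"
  by (induction I rule: infinite_finite_induct) (simp_all add: degle_add)

lemma degle_mult:
  assumes "degle N f" "degle M g"
  shows "degle (N + M) (f * g)"
  unfolding degle_def
proof
  fix m assume "m \<in> keys (f * g)"
  then obtain a b where "a \<in> keys f" "b \<in> keys g" "m = a + b"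
    using keys_mult[of f g] by blast
  then show "tdeg m \<le> N + M" using assms by (simp add: degle_def tdeg_add add_mono)
qed

lemma degle_power:
  fixes f :: "('n, 'k::comm_semiring_1) dpoly"
  shows "degle N f \<Longrightarrow> degle (n * N) (f ^ n)"
  by (induction n) (simp_all add: degle_mult)

lemma dvar_poly_power:
  "(dvar_poly x :: ('n, 'k::comm_semiring_1) dpoly) ^ j = single (single x j) 1"
  by (induction j) (simp_all add: mult_single single_add[symmetric])

definition mon_remove :: "'n dvar \<Rightarrow> 'n dmonom \<Rightarrow> 'n dmonom" where
  "mon_remove x m = m - single x (lookup m x)"

lemma lookup_mon_remove: "lookup (mon_remove x m) v = (if v = x then 0 else lookup m v)"
  by (simp add: mon_remove_def lookup_minus lookup_single)

lemma mon_remove_add: "mon_remove x m + single x (lookup m x) = m"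
  by (rule poly_mapping_eqI) (simp add: lookup_add lookup_mon_remove lookup_single)

lemma keys_mon_remove: "keys (mon_remove x m) = keys m - {x}"
  by (auto simp: in_keys_iff lookup_mon_remove split: if_splits)

lemma tdeg_mon_remove: "tdeg (mon_remove x m) + lookup m x = tdeg m"
  by (metis mon_remove_add tdeg_add tdeg_single)

text \<open>The coefficient of \<open>x\<^sup>j\<close> in \<open>f\<close>, viewed as a polynomial in \<open>x\<close>.\<close>

definition coef :: "'n dvar \<Rightarrow> nat \<Rightarrow> ('n, 'k::zero) dpoly \<Rightarrow> ('n, 'k) dpoly" where
  "coef x j f = Poly_Mapping.mapp (\<lambda>m c. if lookup m x = 0 then c else 0)
     (Poly_Mapping.map_key (\<lambda>m. m + single x j) f)"

lemma inj_add_monom: "inj (\<lambda>m. m + a :: 'n dmonom)"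
  by (simp add: inj_def)

lemma lookup_map_key: "inj h \<Longrightarrow> lookup (Poly_Mapping.map_key h f) m = lookup f (h m)"
  by (simp add: Poly_Mapping.map_key.rep_eq)

lemma lookup_coef: "lookup (coef x j f) m = (if lookup m x = 0 then lookup f (m + single x j) else 0)"
  by (simp add: coef_def lookup_mapp lookup_map_key inj_add_monom when_def in_keys_iff)

lemma coef_add: "coef x j (f + g) = coef x j f + coef x j g"
  by (rule poly_mapping_eqI) (simp add: lookup_coef lookup_add)

lemma coef_zero [simp]: "coef x j 0 = 0"
  by (rule poly_mapping_eqI) (simp add: lookup_coef)

lemma coef_single: "coef x j (single m c) = (if lookup m x = j then single (mon_remove x m) c else 0)"
proof (rule poly_mapping_eqI)
  fix k
  have "lookup k x = 0 \<and> m = k + single x j \<longleftrightarrow> lookup m x = j \<and> mon_remove x m = k"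
  proof (intro iffI conjI)
    assume *: "lookup k x = 0 \<and> m = k + single x j"
    then show "lookup m x = j" by (simp add: lookup_add)
    show "mon_remove x m = k" using *
      by (intro poly_mapping_eqI) (auto simp: lookup_mon_remove lookup_add lookup_single when_def)
  next
    assume *: "lookup m x = j \<and> mon_remove x m = k"
    then show "lookup k x = 0" by (auto simp: lookup_mon_remove)
    show "m = k + single x j" using * mon_remove_add[of x m] by simp
  qed
  then show "lookup (coef x j (single m c)) k =
      lookup (if lookup m x = j then single (mon_remove x m) c else 0) k"
    by (auto simp: lookup_coef lookup_single when_def)
qed

lemma keys_coef: "keys (coef x j f) = {m. lookup m x = 0 \<and> m + single x j \<in> keys f}"
  by (auto simp: in_keys_iff lookup_coef split: if_splits)

lemma dvars_coef: "dvars (coef x j f) \<subseteq> dvars f - {x}"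
proof
  fix v assume "v \<in> dvars (coef x j f)"
  then obtain m where m: "lookup m x = 0" "m + single x j \<in> keys f" "lookup m v \<noteq> 0"
    by (auto simp: dvars_def keys_coef in_keys_iff)
  then have "v \<noteq> x" "v \<in> keys (m + single x j)" by (auto simp: in_keys_iff lookup_add)
  then show "v \<in> dvars f - {x}" using m(2) by (auto simp: dvars_def)
qed

text \<open>Claimed for all large \<open>n\<close>, so that the cut-off can be raised, both in this
  induction and in \<open>algI_coef\<close>.\<close>

lemma coef_expand:
  fixes f :: "('n, 'k::comm_semiring_1) dpoly"
  shows "\<exists>N. \<forall>n\<ge>N. f = (\<Sum>j\<le>n. coef x j f * dvar_poly x ^ j)"
proof (induction f rule: dpoly_induct)
  case (add m c f)
  then obtain N where N: "\<forall>n\<ge>N. f = (\<Sum>j\<le>n. coef x j f * dvar_poly x ^ j)" by blast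
  have "single m c + f = (\<Sum>j\<le>n. coef x j (single m c + f) * dvar_poly x ^ j)"
    if n: "n \<ge> max N (lookup m x)" for n
  proof -
    have "(\<Sum>j\<le>n. coef x j (single m c) * dvar_poly x ^ j) =
        (\<Sum>j\<le>n. if lookup m x = j then single m c else 0)"
      by (intro sum.cong refl)
        (auto simp: coef_single dvar_poly_power mult_single mon_remove_add simp del: One_nat_def)
    also have "\<dots> = single m c" using n by simp
    finally have "(\<Sum>j\<le>n. coef x j (single m c) * dvar_poly x ^ j) = single m c" .
    moreover have "(\<Sum>j\<le>n. coef x j f * dvar_poly x ^ j) = f" using N n by simp
    ultimately show ?thesis
      by (simp only: coef_add distrib_right sum.distrib)
  qed
  then show ?case by blast
qed simp

lemma deg_in_le_iff: "deg_in v f \<le> N \<longleftrightarrow> (\<forall>m\<in>keys f. lookup m v \<le> N)"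
  by (auto simp: deg_in_def)

lemma lookup_le_deg_in: "m \<in> keys f \<Longrightarrow> lookup m v \<le> deg_in v f"
  using deg_in_le_iff by blast

lemma deg_in_attained:
  assumes "f \<noteq> 0"
  obtains m where "m \<in> keys f" "lookup m v = deg_in v f"
proof -
  have "keys f \<noteq> {}" using assms by simp
  then have "deg_in v f = Max ((\<lambda>m. lookup m v) ` keys f)" by (simp add: deg_in_def)
  also have "\<dots> \<in> (\<lambda>m. lookup m v) ` keys f" using \<open>keys f \<noteq> {}\<close> by (intro Max_in) auto
  finally show ?thesis using that by auto
qed

lemma deg_in_pos_iff: "deg_in v f > 0 \<longleftrightarrow> v \<in> dvars f"
  using deg_in_le_iff[of v f 0] by (auto simp: dvars_def in_keys_iff)

lemma deg_in_coef: "deg_in v (coef x j f) \<le> deg_in v f"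
  unfolding deg_in_le_iff keys_coef using lookup_le_deg_in[of _ f v] by (fastforce simp: lookup_add)

text \<open>Take the exponent of \<open>x\<close> in a monomial attaining the degree in
  \<open>v\<close>. Later this allows passing to a coefficient without losing the degree in a
  leader.\<close>

lemma coef_deg_in_attained:
  assumes "f \<noteq> 0" "v \<noteq> x"
  obtains j where "deg_in v (coef x j f) = deg_in v f" "coef x j f \<noteq> 0"
proof -
  obtain m where m: "m \<in> keys f" "lookup m v = deg_in v f" using deg_in_attained[OF assms(1)] .
  have k: "mon_remove x m \<in> keys (coef x (lookup m x) f)"
    using m(1) mon_remove_add[of x m] by (simp add: keys_coef lookup_mon_remove)
  then have "lookup (mon_remove x m) v \<le> deg_in v (coef x (lookup m x) f)"
    by (rule lookup_le_deg_in)
  then have "deg_in v (coef x (lookup m x) f) = deg_in v f"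
    using assms(2) m(2) deg_in_coef[of v x "lookup m x" f] by (simp add: lookup_mon_remove)
  moreover have "coef x (lookup m x) f \<noteq> 0" using k by auto
  ultimately show ?thesis using that by blast
qed


section \<open>Partial derivatives\<close>

text \<open>The formal partial derivative coefficientwise: the shift by \<open>v\<close> fetches the
  coefficient of the monomial one power higher, whose exponent of \<open>v\<close> is the
  factor.\<close>

definition pd :: "'n dvar \<Rightarrow> ('n, 'k::comm_semiring_1) dpoly \<Rightarrow> ('n, 'k) dpoly" where
  "pd v f = Poly_Mapping.mapp (\<lambda>m c. of_nat (lookup m v + 1) * c)
     (Poly_Mapping.map_key (\<lambda>m. m + single v 1) f)"

lemma lookup_pd: "lookup (pd v f) m = of_nat (lookup m v + 1) * lookup f (m + single v 1)"
  by (simp add: pd_def lookup_mapp lookup_map_key inj_add_monom when_def in_keys_iff)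

lemma pd_add: "pd v (f + g) = pd v f + pd v g"
  by (rule poly_mapping_eqI) (simp add: lookup_pd lookup_add algebra_simps)

lemma pd_zero [simp]: "pd v 0 = 0"
  by (rule poly_mapping_eqI) (simp add: lookup_pd)

lemma pd_sum: "pd v (sum f S) = (\<Sum>x\<in>S. pd v (f x))"
  by (induction S rule: infinite_finite_induct) (simp_all add: pd_add)

lemma pd_single: "pd v (single m c) = single (m - single v 1) (of_nat (lookup m v) * c)"
proof (rule poly_mapping_eqI)
  fix k
  consider "m = k + single v 1" | "lookup m v = 0" "m \<noteq> k + single v 1"
    | "lookup m v \<noteq> 0" "m \<noteq> k + single v 1" by blast
  then show "lookup (pd v (single m c)) k =
      lookup (single (m - single v 1) (of_nat (lookup m v) * c)) k"
  proof cases
    case 3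
    then have "m - single v 1 \<noteq> k"
    proof -
      have "m - single v 1 + single v 1 = m" using 3(1)
        by (intro poly_mapping_eqI) (auto simp: lookup_add lookup_minus lookup_single when_def)
      then show ?thesis using 3(2) by auto
    qed
    then show ?thesis using 3 by (simp add: lookup_pd lookup_single)
  qed (auto simp: lookup_pd lookup_single lookup_add)
qed

lemma pd_dconst [simp]: "pd v (dconst c) = 0"
  by (simp add: pd_single)

lemma pd_dvar_poly: "pd v (dvar_poly u) = (if u = v then 1 else 0)"
  by (simp add: pd_single lookup_single)

lemma pd_mult:
  fixes f g :: "('n, 'k::comm_ring_1) dpoly"
  shows "pd v (f * g) = pd v f * g + f * pd v g"
proof -
  have e: "single (m + m' - single v 1) (of_nat (lookup m v) * x) =
      single (m - single v 1 + m') (of_nat (lookup m v) * x)" for m m' :: "'n dmonom" and x :: 'k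
  proof (cases "lookup m v = 0")
    case False
    then show ?thesis by (subst monom_diff_add) simp_all
  qed simp
  have s: "pd v (single m c * single m' c') =
      pd v (single m c) * single m' c' + single m c * pd v (single m' c')" for m m' and c c' :: 'k
  proof -
    have "pd v (single m c * single m' c') =
        single (m + m' - single v 1) (of_nat (lookup m v) * (c * c')) +
        single (m' + m - single v 1) (of_nat (lookup m' v) * (c * c'))"
      by (simp add: pd_single mult_single lookup_add distrib_right add.commute flip: single_add)
    also have "\<dots> = pd v (single m c) * single m' c' + single m c * pd v (single m' c')"
      unfolding e by (simp add: pd_single mult_single add_ac mult_ac)
    finally show ?thesis .
  qed
  have t: "pd v (single m c * g) = pd v (single m c) * g + single m c * pd v g" for m c
    by (induction g rule: dpoly_induct) (simp_all add: pd_add s algebra_simps)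
  show ?thesis
    by (induction f rule: dpoly_induct) (simp_all add: pd_add t distrib_left distrib_right)
qed

lemma derivation_pd: "derivation (pd v :: ('n, 'k::comm_ring_1) dpoly \<Rightarrow> _)"
  by (simp add: derivation_def pd_add pd_mult)

text \<open>In characteristic zero the integer factors do not vanish, so exactly the monomials free
  of \<open>v\<close> are lost.\<close>

lemma keys_pd:
  fixes f :: "('n, 'k::field_char_0) dpoly"
  shows "keys (pd v f) = {m. m + single v 1 \<in> keys f}"
  by (auto simp: in_keys_iff lookup_pd simp del: of_nat_add of_nat_Suc)

lemma dvars_pd:
  fixes f :: "('n, 'k::field_char_0) dpoly"
  shows "dvars (pd v f) \<subseteq> dvars f"
proof
  fix w assume "w \<in> dvars (pd v f)"
  then obtain m where "m + single v 1 \<in> keys f" "w \<in> keys m"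
    by (auto simp: dvars_def keys_pd)
  moreover from this have "w \<in> keys (m + single v 1)" by (simp add: in_keys_iff lookup_add)
  ultimately show "w \<in> dvars f" by (auto simp: dvars_def)
qed

lemma pd_nonzero_iff:
  fixes f :: "('n, 'k::field_char_0) dpoly"
  shows "pd v f \<noteq> 0 \<longleftrightarrow> v \<in> dvars f"
proof
  assume "v \<in> dvars f"
  then obtain m where m: "m \<in> keys f" "lookup m v \<noteq> 0" by (auto simp: dvars_def in_keys_iff)
  then have "m - single v 1 + single v 1 = m"
    by (intro poly_mapping_eqI) (auto simp: lookup_add lookup_minus lookup_single when_def)
  then have "m - single v 1 \<in> keys (pd v f)" using m by (simp add: keys_pd)
  then show "pd v f \<noteq> 0" by auto
next
  assume "pd v f \<noteq> 0"
  then obtain m where "m \<in> keys (pd v f)" by fastforce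
  then show "v \<in> dvars f" by (auto simp: keys_pd dvars_def in_keys_iff lookup_add intro!: bexI)
qed

lemma pd_eq_0:
  fixes f :: "('n, 'k::comm_semiring_1) dpoly"
  assumes "v \<notin> dvars f"
  shows "pd v f = 0"
proof (rule poly_mapping_eqI)
  fix m
  have "m + single v 1 \<notin> keys f"
  proof
    assume "m + single v 1 \<in> keys f"
    moreover have "v \<in> keys (m + single v 1)" by (simp add: in_keys_iff lookup_add)
    ultimately show False using assms by (auto simp: dvars_def)
  qed
  then show "lookup (pd v f) m = lookup 0 m" by (simp add: lookup_pd in_keys_iff)
qed

lemma deg_in_pd:
  fixes f :: "('n, 'k::field_char_0) dpoly"
  shows "deg_in w (pd v f) \<le> deg_in w f"
  unfolding deg_in_le_iff keys_pd using lookup_le_deg_in[of _ f w] by (fastforce simp: lookup_add)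

lemma deg_in_pd_less:
  fixes f :: "('n, 'k::field_char_0) dpoly"
  assumes "v \<in> dvars f"
  shows "deg_in v (pd v f) < deg_in v f"
proof -
  obtain m where m: "m \<in> keys (pd v f)" "lookup m v = deg_in v (pd v f)"
    using deg_in_attained pd_nonzero_iff assms by metis
  then have "m + single v 1 \<in> keys f" by (simp add: keys_pd)
  from lookup_le_deg_in[OF this, of v] show ?thesis using m(2) by (simp add: lookup_add)
qed

lemma degle_pd:
  fixes f :: "('n, 'k::field_char_0) dpoly"
  shows "degle (Suc N) f \<Longrightarrow> degle N (pd v f)"
  by (auto simp: degle_def keys_pd tdeg_add)

section \<open>Derivatives of differential polynomials\<close>

lemma theta_0 [simp]: "theta 0 u = u"
  and fst_theta [simp]: "fst (theta i u) = fst u"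
  and snd_theta [simp]: "snd (theta i u) = snd u + i"
  by (simp_all add: theta_def)

lemma theta_theta [simp]: "theta i (theta j u) = theta (i + j) u"
  by (simp add: theta_def)

lemma theta_inject [simp]: "theta i u = theta i v \<longleftrightarrow> u = v"
  by (auto simp: theta_def prod_eq_iff)

lemma theta_left_inject [simp]: "theta i u = theta j u \<longleftrightarrow> i = j"
  by (auto simp: theta_def)

lemma theta_of_fst_eq: "fst u = fst v \<Longrightarrow> snd u \<le> snd v \<Longrightarrow> v = theta (snd v - snd u) u"
  by (simp add: theta_def prod_eq_iff)

lemma monom_remove_var:
  fixes m :: "'n dmonom"
  assumes "u \<in> keys m"
  shows "m - single u 1 + single u 1 = m"
  using assms
  by (intro poly_mapping_eqI) (auto simp: lookup_add lookup_minus lookup_single when_def in_keys_iff)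

lemma derivation_zero: "derivation D \<Longrightarrow> D 0 = 0"
  unfolding derivation_def by (metis add_cancel_right_right)

lemma derivation_one: "derivation D \<Longrightarrow> D 1 = 0"
  unfolding derivation_def by (metis add_cancel_right_right mult_1 mult_1_right)

lemma derivation_commutator:
  assumes D: "derivation D" and E: "derivation E"
  shows "derivation (\<lambda>x. D (E x) - E (D x))"
  using assms unfolding derivation_def by (simp add: algebra_simps)

text \<open>Split one variable off a monomial and induct on the total degree.\<close>

lemma derivation_eqI:
  fixes D E :: "('n, 'k::comm_ring_1) dpoly \<Rightarrow> ('n, 'k) dpoly"
  assumes D: "derivation D" and E: "derivation E"
    and c: "\<And>c. D (dconst c) = E (dconst c)" and v: "\<And>u. D (dvar_poly u) = E (dvar_poly u)"
  shows "D f = E f"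
proof -
  have m: "D (single m c) = E (single m c)" for m c
  proof (induction "tdeg m" arbitrary: m)
    case 0
    then have "m = 0" using lookup_le_tdeg[of m] by (intro poly_mapping_eqI) (metis le_zero_eq lookup_zero)
    then show ?case by (simp add: c)
  next
    case (Suc n)
    then have "m \<noteq> 0" by auto
    then have "keys m \<noteq> {}" by simp
    then obtain u where u: "u \<in> keys m" by blast
    let ?m = "m - single u 1"
    have "tdeg ?m = n" using Suc(2) tdeg_add[of ?m "single u 1"] monom_remove_var[OF u] by simp
    then have "D (single ?m c) = E (single ?m c)" using Suc(1) by simp
    moreover have "single m c = single ?m c * dvar_poly u"
      using monom_remove_var[OF u] by (simp add: mult_single)
    ultimately show ?case using D E v by (simp add: derivation_def)
  qed
  show ?thesis
    using D E by (induction f rule: dpoly_induct) (simp_all add: derivation_zero, simp add: derivation_def m)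
qed

lemma dvars_dpoly_deriv: "dvars (dpoly_deriv \<delta> f) \<subseteq> dvars f \<union> theta 1 ` dvars f"
  unfolding dpoly_deriv_def
proof (rule dvars_sum)
  fix m assume m: "m \<in> keys f"
  have "keys (m - single u 1 + single (theta 1 u) 1) \<subseteq> insert (theta 1 u) (keys m)" for u
    by (auto simp: in_keys_iff lookup_add lookup_minus lookup_single when_def split: if_splits)
  then have "dvars (dterm_deriv \<delta> m (lookup f m)) \<subseteq> keys m \<union> theta 1 ` keys m"
    unfolding dterm_deriv_def by (intro dvars_add dvars_sum) (auto simp: dvars_single split: if_splits)
  also have "\<dots> \<subseteq> dvars f \<union> theta 1 ` dvars f" using m by (auto simp: dvars_def)
  finally show "dvars (dterm_deriv \<delta> m (lookup f m)) \<subseteq> dvars f \<union> theta 1 ` dvars f" .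
qed

text \<open>The commutator of two derivations is a derivation, so it can be compared with
  \<open>pd v\<close> on constants and variables alone.\<close>

lemma pd_dpoly_deriv:
  fixes f :: "('n, 'k::comm_ring_1) dpoly"
  assumes "derivation \<delta>"
  shows "pd (theta 1 v) (dpoly_deriv \<delta> f) = dpoly_deriv \<delta> (pd (theta 1 v) f) + pd v f"
proof -
  note D = derivation_dpoly_deriv[OF assms, where 'n = 'n]
  have "pd (theta 1 v) (dpoly_deriv \<delta> f) - dpoly_deriv \<delta> (pd (theta 1 v) f) = pd v f"
    by (rule derivation_eqI[OF derivation_commutator[OF derivation_pd D] derivation_pd])
      (simp_all add: dpoly_deriv_dconst[OF assms] dpoly_deriv_dvar_poly[OF assms] derivation_zero[OF D]
        derivation_one[OF D] pd_dvar_poly del: One_nat_def)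
  then show ?thesis by (simp add: algebra_simps)
qed

lemma dvars_dpoly_deriv_pow:
  "dvars ((dpoly_deriv \<delta> ^^ m) f) \<subseteq> {theta j w | j w. j \<le> m \<and> w \<in> dvars f}"
proof (induction m)
  case 0
  then show ?case by (force intro: exI[of _ 0])
next
  case (Suc m)
  show ?case
  proof
    fix x assume "x \<in> dvars ((dpoly_deriv \<delta> ^^ Suc m) f)"
    then consider "x \<in> dvars ((dpoly_deriv \<delta> ^^ m) f)"
      | y where "y \<in> dvars ((dpoly_deriv \<delta> ^^ m) f)" "x = theta 1 y"
      using dvars_dpoly_deriv[of \<delta> "(dpoly_deriv \<delta> ^^ m) f"] by auto
    then show "x \<in> {theta j w | j w. j \<le> Suc m \<and> w \<in> dvars f}"
    proof cases
      case 1
      then show ?thesis using Suc by (fastforce intro: le_SucI)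
    next
      case 2
      then obtain j w where "j \<le> m" "w \<in> dvars f" "x = theta (Suc j) w"
        using Suc by auto
      then show ?thesis by blast
    qed
  qed
qed

text \<open>\<open>theta (Suc m) v\<close> does not occur in the \<open>m\<close>-th derivative, so
  at each step only the second summand of \<open>pd_dpoly_deriv\<close> survives. If
  \<open>v\<close> is the leader of \<open>f\<close>, the value is the separant.\<close>

lemma pd_dpoly_deriv_pow:
  fixes f :: "('n, 'k::comm_ring_1) dpoly"
  assumes "derivation \<delta>" "\<And>i. i > 0 \<Longrightarrow> theta i v \<notin> dvars f"
  shows "pd (theta m v) ((dpoly_deriv \<delta> ^^ m) f) = pd v f"
proof (induction m)
  case (Suc m)
  let ?g = "(dpoly_deriv \<delta> ^^ m) f"
  have "theta (Suc m) v \<notin> dvars ?g"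
  proof
    assume "theta (Suc m) v \<in> dvars ?g"
    then obtain j w where jw: "j \<le> m" "w \<in> dvars f" "theta (Suc m) v = theta j w"
      using dvars_dpoly_deriv_pow[where \<delta> = \<delta> and m = m and f = f] by auto
    then have "w = theta (Suc m - j) v"
      by (metis fst_theta snd_theta theta_of_fst_eq theta_theta theta_inject le_add_diff_inverse le_SucI)
    then show False using assms(2)[of "Suc m - j"] jw by simp
  qed
  then have "pd (theta 1 (theta m v)) ?g = 0" by (intro pd_eq_0) simp
  then have "pd (theta 1 (theta m v)) (dpoly_deriv \<delta> ?g) = pd (theta m v) ?g"
    using pd_dpoly_deriv[OF assms(1), of "theta m v" ?g]
    by (simp add: derivation_zero[OF derivation_dpoly_deriv[OF assms(1)]])
  then show ?case using Suc by simp
qed simp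


section \<open>Algebraic dependence modulo a prime differential ideal\<close>

locale prime_dideal =
  fixes \<delta> :: "'k::field_char_0 \<Rightarrow> 'k" and P :: "('n, 'k) dpoly set"
  assumes derivation: "derivation \<delta>" and prime_diff_ideal: "prime_diff_ideal \<delta> P"
begin

lemma P_zero [simp]: "0 \<in> P"
  and P_add: "f \<in> P \<Longrightarrow> g \<in> P \<Longrightarrow> f + g \<in> P"
  and P_mult: "g \<in> P \<Longrightarrow> f * g \<in> P"
  and P_deriv: "f \<in> P \<Longrightarrow> dpoly_deriv \<delta> f \<in> P"
  and P_one [simp]: "1 \<notin> P"
  and P_prime: "f * g \<in> P \<Longrightarrow> f \<in> P \<or> g \<in> P"
  using prime_diff_ideal unfolding prime_diff_ideal_def by blast+

lemma P_mult_right: "f \<in> P \<Longrightarrow> f * g \<in> P"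
  using P_mult[of f g] by (simp add: mult.commute)

lemma P_diff: "f \<in> P \<Longrightarrow> g \<in> P \<Longrightarrow> f - g \<in> P"
  using P_add[of f "- 1 * g"] P_mult[of g "- 1"] by simp

lemma P_sum: "(\<And>i. i \<in> I \<Longrightarrow> f i \<in> P) \<Longrightarrow> sum f I \<in> P"
  by (induction I rule: infinite_finite_induct) (simp_all add: P_add)

lemma P_power: "f \<notin> P \<Longrightarrow> f ^ n \<notin> P"
  by (induction n) (use P_prime in auto)

lemma P_deriv_pow: "f \<in> P \<Longrightarrow> (dpoly_deriv \<delta> ^^ m) f \<in> P"
  by (induction m) (simp_all add: P_deriv)

lemma P_dconst: "dconst c \<in> P \<longleftrightarrow> c = 0"
proof
  assume "dconst c \<in> P"
  show "c = 0"
  proof (rule ccontr)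
    assume "c \<noteq> 0"
    then have "dconst (1 / c) * dconst c = (1 :: ('n, 'k) dpoly)" by (simp add: mult_single)
    then show False using P_mult[OF \<open>dconst c \<in> P\<close>, of "dconst (1 / c)"] by simp
  qed
qed simp

lemma P_not_const: "f \<in> P \<Longrightarrow> f \<noteq> 0 \<Longrightarrow> f \<notin> range dconst"
  using P_dconst by auto

text \<open>\<open>x\<close> is algebraic over \<open>k(Y)\<close> in the fraction field of \<open>k{y}/P\<close>, with denominators
  cleared. The closure \<open>acl\<close> iterates this, which makes transitivity a triviality; that iterating does not
  matter for transcendence degrees is shown in \<open>indep_card_le\<close>.\<close>

definition alg :: "'n dvar set \<Rightarrow> 'n dvar \<Rightarrow> bool" where
  "alg Y x \<longleftrightarrow> (\<exists>d c. (\<forall>j\<le>d. dvars (c j) \<subseteq> Y) \<and> c d \<notin> P \<and> (\<Sum>j\<le>d. c j * dvar_poly x ^ j) \<in> P)"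

text \<open>Algebraic independence of the residue classes modulo \<open>P\<close>.\<close>

definition indep :: "'n dvar set \<Rightarrow> bool" where
  "indep S \<longleftrightarrow> (\<forall>f\<in>P. dvars f \<subseteq> S \<longrightarrow> f = 0)"

inductive_set acl :: "'n dvar set \<Rightarrow> 'n dvar set" for B where
  base: "x \<in> B \<Longrightarrow> x \<in> acl B"
| step: "finite Y \<Longrightarrow> (\<And>y. y \<in> Y \<Longrightarrow> y \<in> acl B) \<Longrightarrow> alg Y x \<Longrightarrow> x \<in> acl B"

lemma alg_mono: "alg Y x \<Longrightarrow> Y \<subseteq> Z \<Longrightarrow> alg Z x"
  unfolding alg_def by (meson subset_trans)

text \<open>The highest coefficient outside \<open>P\<close> becomes the leading one; all terms
  above it lie in \<open>P\<close> and are subtracted.\<close>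

lemma algI_coef:
  assumes f: "f \<in> P" "dvars f \<subseteq> insert x Y" and j: "coef x j f \<notin> P"
  shows "alg Y x"
proof -
  obtain N' where N': "\<forall>n\<ge>N'. f = (\<Sum>j\<le>n. coef x j f * dvar_poly x ^ j)"
    using coef_expand by blast
  define N where "N = max N' j"
  have N: "f = (\<Sum>j\<le>N. coef x j f * dvar_poly x ^ j)" using N' by (simp add: N_def)
  let ?J = "{j. j \<le> N \<and> coef x j f \<notin> P}"
  have "?J \<noteq> {}" using j by (auto simp: N_def intro: exI[of _ j])
  define d where "d = Max ?J"
  have "d \<in> ?J" unfolding d_def using \<open>?J \<noteq> {}\<close> by (intro Max_in) auto
  then have d: "d \<le> N" "coef x d f \<notin> P" by auto
  have above: "coef x i f \<in> P" if "i \<in> {..N} - {..d}" for i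
  proof (rule ccontr)
    assume "coef x i f \<notin> P"
    then have "i \<in> ?J" using that by simp
    then have "i \<le> d" unfolding d_def by (intro Max_ge) auto
    then show False using that by simp
  qed
  have "(\<Sum>j\<le>N. coef x j f * dvar_poly x ^ j) =
      (\<Sum>j\<in>{..N} - {..d}. coef x j f * dvar_poly x ^ j) + (\<Sum>j\<le>d. coef x j f * dvar_poly x ^ j)"
    using d(1) by (intro sum.subset_diff) auto
  then have "(\<Sum>j\<le>d. coef x j f * dvar_poly x ^ j) =
      f - (\<Sum>j\<in>{..N} - {..d}. coef x j f * dvar_poly x ^ j)"
    by (simp only: N[symmetric] eq_diff_eq add.commute)
  also have "\<dots> \<in> P" by (intro P_diff f(1) P_sum P_mult_right above)
  finally have "(\<Sum>j\<le>d. coef x j f * dvar_poly x ^ j) \<in> P" .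
  moreover have "dvars (coef x j f) \<subseteq> Y" for j using dvars_coef[of x j f] f(2) by blast
  ultimately show ?thesis
    unfolding alg_def using d(2) by (intro exI[of _ d] exI[of _ "\<lambda>j. coef x j f"]) simp
qed

text \<open>The derivative is a combination of the coefficients of \<open>f\<close> in
  \<open>x\<close>, so one of these must lie outside \<open>P\<close>.\<close>

lemma algI_pd:
  assumes f: "f \<in> P" "dvars f \<subseteq> insert x Y" and x: "pd x f \<notin> P"
  shows "alg Y x"
proof -
  obtain N where N: "f = (\<Sum>j\<le>N. coef x j f * dvar_poly x ^ j)" using coef_expand by blast
  have "pd x (coef x j f) = 0" for j using dvars_coef by (intro pd_eq_0) blast
  then have "pd x f = (\<Sum>j\<le>N. coef x j f * pd x (dvar_poly x ^ j))"
    by (subst N) (simp add: pd_sum pd_mult)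
  then have "\<not> (\<forall>j. coef x j f \<in> P)" using x by (auto intro: P_sum P_mult_right)
  then obtain j where "coef x j f \<notin> P" by blast
  then show ?thesis by (rule algI_coef[OF f])
qed

lemma acl_mono: "x \<in> acl B \<Longrightarrow> B \<subseteq> C \<Longrightarrow> x \<in> acl C"
  by (induction rule: acl.induct) (auto intro: acl.intros)

lemma acl_idem: "x \<in> acl C \<Longrightarrow> C \<subseteq> acl B \<Longrightarrow> x \<in> acl B"
  by (induction rule: acl.induct) (auto intro: acl.intros)

lemma acl_finite: "x \<in> acl B \<Longrightarrow> \<exists>B'. finite B' \<and> B' \<subseteq> B \<and> x \<in> acl B'"
proof (induction rule: acl.induct)
  case (base x)
  then show ?case by (intro exI[of _ "{x}"]) (simp add: acl.base)
next
  case (step Y x)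
  then obtain B' where B': "\<forall>y\<in>Y. finite (B' y) \<and> B' y \<subseteq> B \<and> y \<in> acl (B' y)"
    by metis
  have "x \<in> acl (\<Union>y\<in>Y. B' y)"
  proof (rule acl.step[OF step(1) _ step(3)])
    fix y assume "y \<in> Y"
    then show "y \<in> acl (\<Union>y\<in>Y. B' y)" using B' acl_mono[of y "B' y"] by blast
  qed
  then show ?case using step(1) B' by (intro exI[of _ "\<Union>y\<in>Y. B' y"]) auto
qed

lemma aclI_pd:
  assumes f: "f \<in> P" "dvars f \<subseteq> insert x (acl B)" and x: "pd x f \<notin> P"
  shows "x \<in> acl B"
proof (rule acl.step)
  show "finite (dvars f - {x})" by (simp add: finite_dvars)
  show "alg (dvars f - {x}) x" by (rule algI_pd[OF f(1) _ x]) auto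
qed (use f(2) in auto)

lemma aclI_coef:
  assumes f: "f \<in> P" "dvars f \<subseteq> insert x (acl B)" and x: "coef x j f \<notin> P"
  shows "x \<in> acl B"
proof (rule acl.step)
  show "finite (dvars f - {x})" by (simp add: finite_dvars)
  show "alg (dvars f - {x}) x" by (rule algI_coef[OF f(1) _ x]) auto
qed (use f(2) in auto)

end

section \<open>Transcendence degrees by counting dimensions\<close>

text \<open>Bounding each exponent, not the total degree, makes the number of monomials exactly a
  power of \<open>N + 1\<close>.\<close>

definition box :: "'n dvar set \<Rightarrow> nat \<Rightarrow> 'n dmonom set" where
  "box S N = {m. keys m \<subseteq> S \<and> (\<forall>v. lookup m v \<le> N)}"

lemma bij_betw_box:
  assumes "finite S"
  shows "bij_betw (\<lambda>m. restrict (lookup m) S) (box S N) (S \<rightarrow>\<^sub>E {..N})"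
proof (rule bij_betw_byWitness[where f' = "\<lambda>f. Abs_poly_mapping (\<lambda>v. if v \<in> S then f v else 0)"])
  have fin: "finite {v. (if v \<in> S then f v else 0) \<noteq> 0}" for f :: "'a dvar \<Rightarrow> nat"
    by (rule finite_subset[OF _ assms]) auto
  show "\<forall>m\<in>box S N. Abs_poly_mapping (\<lambda>v. if v \<in> S then restrict (lookup m) S v else 0) = m"
  proof
    fix m assume "m \<in> box S N"
    then have "lookup m v = 0" if "v \<notin> S" for v using that by (auto simp: box_def in_keys_iff)
    then show "Abs_poly_mapping (\<lambda>v. if v \<in> S then restrict (lookup m) S v else 0) = m"
      by (intro poly_mapping_eqI) (simp add: lookup_Abs_poly_mapping[OF fin])
  qed
  show "\<forall>f\<in>S \<rightarrow>\<^sub>E {..N}.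
      restrict (lookup (Abs_poly_mapping (\<lambda>v. if v \<in> S then f v else 0))) S = f"
    by (auto simp: lookup_Abs_poly_mapping[OF fin] PiE_iff extensional_def fun_eq_iff)
  show "(\<lambda>m. restrict (lookup m) S) ` box S N \<subseteq> S \<rightarrow>\<^sub>E {..N}"
    by (auto simp: box_def)
  show "(\<lambda>f. Abs_poly_mapping (\<lambda>v. if v \<in> S then f v else 0)) ` (S \<rightarrow>\<^sub>E {..N}) \<subseteq> box S N"
    by (auto simp: box_def lookup_Abs_poly_mapping[OF fin] in_keys_iff split: if_splits)
qed

lemma finite_box: "finite S \<Longrightarrow> finite (box S N)"
  using bij_betw_finite[OF bij_betw_box, of S N] by (simp add: finite_PiE)

lemma card_box: "finite S \<Longrightarrow> card (box S N) = (N + 1) ^ card S"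
  using bij_betw_same_card[OF bij_betw_box, of S N] by (simp add: card_PiE)

lemma tdeg_box: "finite S \<Longrightarrow> m \<in> box S N \<Longrightarrow> tdeg m \<le> N * card S"
  using sum_bounded_above[of S "lookup m" N]
  unfolding box_def mem_Collect_eq by (simp only: tdeg_superset[of S m] of_nat_id mult.commute[of N])

interpretation dpoly: vector_space "\<lambda>(c :: 'k::field) (f :: ('n, 'k) dpoly). dconst c * f"
  by unfold_locales (simp_all add: algebra_simps single_add mult_single)

lemma single_conv_dconst: "single m c = dconst c * single m (1 :: 'k::comm_semiring_1)"
  by (simp add: mult_single)

context prime_dideal
begin

text \<open>Towers over \<open>B\<close>: each new variable is algebraic over everything adjoined
  before. Arranging the tree behind a membership in \<open>acl B\<close> as a tower gives the
  induction for the growth bound.\<close>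

inductive tri :: "'n dvar set \<Rightarrow> 'n dvar set \<Rightarrow> bool" for B where
  tri_base: "tri B B"
| tri_step: "tri B A \<Longrightarrow> alg A x \<Longrightarrow> tri B (insert x A)"

lemma tri_subset: "tri B A \<Longrightarrow> B \<subseteq> A"
  by (induction rule: tri.induct) auto

lemma tri_union:
  assumes "tri B A'" "tri B A"
  shows "tri B (A \<union> A')"
  using assms(2)
proof (induction rule: tri.induct)
  case tri_base
  then show ?case using assms(1) tri_subset[OF assms(1)] by (simp add: Un_absorb1)
next
  case (tri_step A x)
  then have "alg (A \<union> A') x" by (blast intro: alg_mono)
  then show ?case using tri_step tri.tri_step by simp
qed

lemma tri_finite:
  assumes "finite Y" "\<And>y. y \<in> Y \<Longrightarrow> \<exists>A. tri B A \<and> y \<in> A"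
  shows "\<exists>A. tri B A \<and> Y \<subseteq> A"
  using assms
proof (induction Y rule: finite_induct)
  case empty
  show ?case using tri_base by blast
next
  case (insert y Y)
  then obtain A A' where A: "tri B A" "y \<in> A" "tri B A'" "Y \<subseteq> A'" by blast
  then show ?case using tri_union[OF A(1,3)] by blast
qed

lemma acl_tri: "x \<in> acl B \<Longrightarrow> \<exists>A. tri B A \<and> x \<in> A"
proof (induction rule: acl.induct)
  case (base x)
  then show ?case using tri_base by blast
next
  case (step Y x)
  then obtain A where "tri B A" "Y \<subseteq> A" using tri_finite[of Y B] by blast
  then show ?case using tri_step alg_mono step(3) by blast
qed

text \<open>Pseudo-division of \<open>x ^ j\<close> by the relation for \<open>x\<close>. Each
  further power of \<open>x\<close> costs one factor of the leading coefficient and at most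
  \<open>e\<close> in degree.\<close>

lemma alg_reduce_power:
  assumes c: "\<And>i. i \<le> Suc d \<Longrightarrow> dvars (c i) \<subseteq> A \<and> degle e (c i)"
    and P: "(\<Sum>i\<le>Suc d. c i * x ^ i) \<in> P"
  shows "\<exists>g. (\<forall>i\<le>d. dvars (g i) \<subseteq> A \<and> degle (j * e) (g i)) \<and>
    c (Suc d) ^ j * x ^ j - (\<Sum>i\<le>d. g i * x ^ i) \<in> P"
proof (induction j)
  case 0
  have "(\<Sum>i\<le>d. (if i = 0 then 1 else 0) * x ^ i) = (\<Sum>i\<le>d. if i = 0 then 1 else 0)"
    by (intro sum.cong) auto
  then show ?case by (intro exI[of _ "\<lambda>i. if i = 0 then 1 else 0"]) simp
next
  case (Suc j)
  then obtain g where g: "\<forall>i\<le>d. dvars (g i) \<subseteq> A \<and> degle (j * e) (g i)"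
      "c (Suc d) ^ j * x ^ j - (\<Sum>i\<le>d. g i * x ^ i) \<in> P" by blast
  let ?a = "c (Suc d)"
  \<comment> \<open>Multiply the old remainder by \<open>?a * x\<close> and cancel its new top term
    with \<open>g d\<close> times the relation.\<close>
  define g' where "g' i = (if i = 0 then 0 else ?a * g (i - 1)) - g d * c i" for i
  have "degle (e + j * e) (g' i) \<and> dvars (g' i) \<subseteq> A" if i: "i \<le> d" for i
  proof -
    have a: "degle e ?a" "dvars ?a \<subseteq> A" and ci: "degle e (c i)" "dvars (c i) \<subseteq> A"
      using c i by auto
    have gi: "degle (j * e) (g (i - 1))" "dvars (g (i - 1)) \<subseteq> A"
      and gd: "degle (j * e) (g d)" "dvars (g d) \<subseteq> A"
      using g(1) i by auto
    show ?thesis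
      unfolding g'_def using degle_mult[OF a(1) gi(1)] degle_mult[OF ci(1) gd(1)] a ci gi gd
      by (simp add: degle_diff dvars_diff dvars_mult mult.commute[of "g d"])
  qed
  then have *: "\<forall>i\<le>d. dvars (g' i) \<subseteq> A \<and> degle (Suc j * e) (g' i)" by simp
  have "(\<Sum>i\<le>d. (if i = 0 then 0 else ?a * g (i - 1)) * x ^ i) + ?a * g d * x ^ Suc d =
      (\<Sum>i\<le>Suc d. (if i = 0 then 0 else ?a * g (i - 1)) * x ^ i)" by simp
  also have "\<dots> = ?a * x * (\<Sum>i\<le>d. g i * x ^ i)"
    by (subst sum.atMost_Suc_shift) (simp add: sum_distrib_left mult_ac)
  finally have e: "?a * x * (\<Sum>i\<le>d. g i * x ^ i) =
      (\<Sum>i\<le>d. (if i = 0 then 0 else ?a * g (i - 1)) * x ^ i) + ?a * g d * x ^ Suc d" by simp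
  have "?a ^ Suc j * x ^ Suc j - (\<Sum>i\<le>d. g' i * x ^ i) =
      ?a * x * (?a ^ j * x ^ j - (\<Sum>i\<le>d. g i * x ^ i)) + g d * (\<Sum>i\<le>Suc d. c i * x ^ i)"
    unfolding right_diff_distrib e
    by (simp add: g'_def left_diff_distrib sum_subtractf sum_distrib_left algebra_simps)
  also have "\<dots> \<in> P" by (intro P_add P_mult g(2) P)
  finally show ?case using * by blast
qed

text \<open>One denominator \<open>a ^ N\<close> serves all polynomials of degree at most
  \<open>N\<close>, and the degrees grow only by a constant factor.\<close>

lemma alg_reduce:
  assumes "alg A x"
  obtains a d e where "a \<notin> P" "\<And>N f. dvars f \<subseteq> insert x A \<Longrightarrow> degle N f \<Longrightarrow>
    \<exists>g. (\<forall>i\<le>d. dvars (g i) \<subseteq> A \<and> degle (N * Suc e) (g i)) \<and>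
      a ^ N * f - (\<Sum>i\<le>d. g i * dvar_poly x ^ i) \<in> P"
proof -
  obtain d' c where c: "\<forall>j\<le>d'. dvars (c j) \<subseteq> A" "c d' \<notin> P" "(\<Sum>j\<le>d'. c j * dvar_poly x ^ j) \<in> P"
    using assms unfolding alg_def by blast
  \<comment> \<open>Degree zero is excluded: the relation would then put \<open>c 0\<close> into
    \<open>P\<close>.\<close>
  then obtain d where d: "d' = Suc d" by (cases d') auto
  have "\<forall>j. \<exists>N. degle N (c j)" using degle_exists by blast
  then obtain E where E: "degle (E j) (c j)" for j by metis
  define e where "e = (\<Sum>j\<le>d'. E j)"
  have e: "degle e (c j)" if "j \<le> d'" for j
    using E by (rule degle_mono) (use that in \<open>auto simp: e_def intro: member_le_sum\<close>)
  let ?a = "c d'"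
  have a: "dvars ?a \<subseteq> A" "degle e ?a" using c e by auto
  have "\<exists>g. (\<forall>i\<le>d. dvars (g i) \<subseteq> A \<and> degle (N * Suc e) (g i)) \<and>
      ?a ^ N * f - (\<Sum>i\<le>d. g i * dvar_poly x ^ i) \<in> P"
    if f: "dvars f \<subseteq> insert x A" "degle N f" for N f
  proof -
    define R where "R m g \<longleftrightarrow> (\<forall>i\<le>d. dvars (g i) \<subseteq> A \<and> degle (N * Suc e) (g i)) \<and>
        ?a ^ N * single m (lookup f m) - (\<Sum>i\<le>d. g i * dvar_poly x ^ i) \<in> P" for m g
    have "\<exists>g. R m g" if m: "m \<in> keys f" for m
    proof -
      let ?j = "lookup m x" and ?s = "single (mon_remove x m) (lookup f m)"
      obtain g where g: "\<forall>i\<le>d. dvars (g i) \<subseteq> A \<and> degle (?j * e) (g i)"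
          "?a ^ ?j * dvar_poly x ^ ?j - (\<Sum>i\<le>d. g i * dvar_poly x ^ i) \<in> P"
        using alg_reduce_power[of d c A e "dvar_poly x" ?j] c e d by auto
      have t: "tdeg (mon_remove x m) + ?j \<le> N" using f(2) m by (simp add: degle_def tdeg_mon_remove)
      \<comment> \<open>The spare factors \<open>?a ^ (N - ?j)\<close> bring all monomials to the
        common denominator.\<close>
      define r where "r = ?a ^ (N - ?j) * ?s"
      have "keys (mon_remove x m) \<subseteq> A" using f(1) m by (auto simp: keys_mon_remove dvars_def)
      then have r: "dvars r \<subseteq> A" unfolding r_def using a
        by (intro dvars_mult dvars_power) (auto simp: dvars_single)
      have "degle ((N - ?j) * e + (N - ?j)) r" unfolding r_def using a t
        by (intro degle_mult degle_power degle_single) auto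
      then have "degle ((N - ?j) * e + (N - ?j) + ?j * e) (r * g i)" if "i \<le> d" for i
        using g(1) that by (intro degle_mult) auto
      moreover have "(N - ?j) * e + ?j * e = N * e" using t by (simp flip: add_mult_distrib)
      then have "(N - ?j) * e + (N - ?j) + ?j * e \<le> N * Suc e" by simp
      ultimately have "\<forall>i\<le>d. dvars (r * g i) \<subseteq> A \<and> degle (N * Suc e) (r * g i)"
        using g(1) r by (meson degle_mono dvars_mult)
      moreover have "single m (lookup f m) = ?s * dvar_poly x ^ ?j"
        by (simp only: dvar_poly_power mult_single mon_remove_add mult_1_right)
      then have "?a ^ N * single m (lookup f m) = r * (?a ^ ?j * dvar_poly x ^ ?j)"
      proof -
        have "?a ^ N = ?a ^ (N - ?j) * ?a ^ ?j" using t by (simp flip: power_add)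
        then show ?thesis
          using \<open>single m (lookup f m) = ?s * dvar_poly x ^ ?j\<close> by (simp only: r_def mult_ac)
      qed
      then have "?a ^ N * single m (lookup f m) - (\<Sum>i\<le>d. r * g i * dvar_poly x ^ i) =
          r * (?a ^ ?j * dvar_poly x ^ ?j - (\<Sum>i\<le>d. g i * dvar_poly x ^ i))"
        by (simp add: right_diff_distrib sum_distrib_left mult_ac)
      then have "?a ^ N * single m (lookup f m) - (\<Sum>i\<le>d. r * g i * dvar_poly x ^ i) \<in> P"
        using P_mult[OF g(2)] by simp
      ultimately have "R m (\<lambda>i. r * g i)" unfolding R_def by blast
      then show ?thesis by blast
    qed
    then obtain g where "\<forall>m\<in>keys f. R m (g m)" by metis
    then have g: "\<forall>m\<in>keys f. (\<forall>i\<le>d. dvars (g m i) \<subseteq> A \<and> degle (N * Suc e) (g m i)) \<and>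
        ?a ^ N * single m (lookup f m) - (\<Sum>i\<le>d. g m i * dvar_poly x ^ i) \<in> P"
      unfolding R_def .
    let ?g = "\<lambda>i. \<Sum>m\<in>keys f. g m i"
    have "?a ^ N * f - (\<Sum>i\<le>d. ?g i * dvar_poly x ^ i) =
        (\<Sum>m\<in>keys f. ?a ^ N * single m (lookup f m) - (\<Sum>i\<le>d. g m i * dvar_poly x ^ i))"
      unfolding sum_subtractf sum_distrib_left[symmetric] sum_single_keys sum_distrib_right
      by (subst (2) sum.swap) (rule refl)
    also have "\<dots> \<in> P" using g by (intro P_sum) blast
    finally have "?a ^ N * f - (\<Sum>i\<le>d. ?g i * dvar_poly x ^ i) \<in> P" .
    moreover have "\<forall>i\<le>d. dvars (?g i) \<subseteq> A \<and> degle (N * Suc e) (?g i)"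
      using g by (auto intro!: dvars_sum degle_sum)
    ultimately show ?thesis by (intro exI[of _ ?g] conjI)
  qed
  with c(2) show thesis by (rule that)
qed

lemma subspace_P: "dpoly.subspace P"
  by (rule dpoly.subspaceI) (auto intro: P_add P_mult)

text \<open>The dimension over \<open>k\<close> of the polynomials of degree \<open>\<le> N\<close> in the variables \<open>A\<close>
  modulo \<open>P\<close> grows at most like \<open>N\<close> to the power \<open>card B\<close>.\<close>

lemma tri_growth:
  assumes "tri B A" "finite B"
  shows "\<exists>c D. \<forall>N>0. \<exists>h G. h \<notin> P \<and> finite G \<and> card G \<le> D * (c * N) ^ card B \<and>
    (\<forall>f. dvars f \<subseteq> A \<longrightarrow> degle N f \<longrightarrow> h * f \<in> dpoly.span (G \<union> P))"
  using assms(1)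
proof (induction rule: tri.induct)
  case tri_base
  have "\<exists>h G. h \<notin> P \<and> finite G \<and> card G \<le> 1 * (2 * N) ^ card B \<and>
    (\<forall>f. dvars f \<subseteq> B \<longrightarrow> degle N f \<longrightarrow> h * f \<in> dpoly.span (G \<union> P))" if "N > 0" for N
  proof (intro exI conjI allI impI)
    \<comment> \<open>Monomials of degree at most \<open>N\<close> lie in the box; since
      \<open>N > 0\<close>, its size is at most \<open>(2 * N) ^ card B\<close>.\<close>
    let ?G = "(\<lambda>m. single m 1) ` box B N"
    show "1 \<notin> P" "finite ?G" by (simp_all add: finite_box assms)
    have "card ?G \<le> card (box B N)" using finite_box[OF assms(2)] by (rule card_image_le)
    also have "\<dots> = (N + 1) ^ card B" by (rule card_box[OF assms(2)])
    also have "\<dots> \<le> (2 * N) ^ card B" using that by (intro power_mono) auto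
    also have "\<dots> = 1 * (2 * N) ^ card B" by simp
    finally show "card ?G \<le> 1 * (2 * N) ^ card B" .
    fix f :: "('n, 'k) dpoly"
    assume f: "dvars f \<subseteq> B" "degle N f"
    have "(\<Sum>m\<in>keys f. single m (lookup f m)) \<in> dpoly.span (?G \<union> P)"
    proof (rule dpoly.span_sum)
      fix m assume m: "m \<in> keys f"
      have "lookup m v \<le> N" for v
        using f(2) m lookup_le_tdeg[of m v] by (auto simp: degle_def intro: order_trans)
      then have "m \<in> box B N" using f(1) m by (auto simp: box_def dvars_def)
      then have "dconst (lookup f m) * single m 1 \<in> dpoly.span (?G \<union> P)"
        by (intro dpoly.span_scale dpoly.span_base) blast
      then show "single m (lookup f m) \<in> dpoly.span (?G \<union> P)"
        using single_conv_dconst[of m "lookup f m"] by simp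
    qed
    then show "1 * f \<in> dpoly.span (?G \<union> P)" by (simp add: sum_single_keys)
  qed
  then show ?case by blast
next
  case (tri_step A x)
  then obtain c D where IH: "\<And>N. N > 0 \<Longrightarrow> \<exists>h G. h \<notin> P \<and> finite G \<and> card G \<le> D * (c * N) ^ card B \<and>
    (\<forall>f. dvars f \<subseteq> A \<longrightarrow> degle N f \<longrightarrow> h * f \<in> dpoly.span (G \<union> P))" by blast
  obtain a d e where a: "a \<notin> P" and red: "\<And>N f. dvars f \<subseteq> insert x A \<Longrightarrow> degle N f \<Longrightarrow>
      \<exists>g. (\<forall>i\<le>d. dvars (g i) \<subseteq> A \<and> degle (N * Suc e) (g i)) \<and>
        a ^ N * f - (\<Sum>i\<le>d. g i * dvar_poly x ^ i) \<in> P"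
    using alg_reduce[OF tri_step(2)] by blast
  have "\<exists>h G. h \<notin> P \<and> finite G \<and> card G \<le> (Suc d * D) * ((c * Suc e) * N) ^ card B \<and>
    (\<forall>f. dvars f \<subseteq> insert x A \<longrightarrow> degle N f \<longrightarrow> h * f \<in> dpoly.span (G \<union> P))" if N: "N > 0" for N
  proof -
    obtain h G where h: "h \<notin> P" "finite G" "card G \<le> D * (c * (N * Suc e)) ^ card B"
      and span: "\<And>f. dvars f \<subseteq> A \<Longrightarrow> degle (N * Suc e) f \<Longrightarrow> h * f \<in> dpoly.span (G \<union> P)"
      using IH[of "N * Suc e"] N by auto
    \<comment> \<open>Adjoining \<open>x\<close> multiplies the number of generators by at most
      \<open>Suc d\<close> and replaces \<open>N\<close> by \<open>N * Suc e\<close>: only the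
      constants change, not the exponent \<open>card B\<close>.\<close>
    let ?G = "(\<lambda>(i, g). g * dvar_poly x ^ i) ` ({..d} \<times> G)"
    have shift: "y * dvar_poly x ^ i \<in> dpoly.span (?G \<union> P)"
      if "y \<in> dpoly.span (G \<union> P)" "i \<le> d" for y i
      using that(1)
    proof (induction rule: dpoly.span_induct_alt)
      case base
      then show ?case by (simp add: dpoly.span_zero)
    next
      case (step k g y)
      have "g * dvar_poly x ^ i \<in> ?G \<union> P"
        using step(1) that(2) P_mult_right[of g] by (force intro: image_eqI[of _ _ "(i, g)"])
      then have "dconst k * (g * dvar_poly x ^ i) + y * dvar_poly x ^ i \<in> dpoly.span (?G \<union> P)"
        by (intro dpoly.span_add dpoly.span_scale dpoly.span_base step(2))
      then show ?case by (simp add: distrib_right mult.assoc)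
    qed
    have "h * a ^ N * f \<in> dpoly.span (?G \<union> P)" if f: "dvars f \<subseteq> insert x A" "degle N f" for f
    proof -
      obtain g where g: "\<forall>i\<le>d. dvars (g i) \<subseteq> A \<and> degle (N * Suc e) (g i)"
        "a ^ N * f - (\<Sum>i\<le>d. g i * dvar_poly x ^ i) \<in> P" using red[OF f] by blast
      have "(\<Sum>i\<le>d. (h * g i) * dvar_poly x ^ i) \<in> dpoly.span (?G \<union> P)"
        using g(1) by (intro dpoly.span_sum shift span) auto
      moreover have "h * (a ^ N * f - (\<Sum>i\<le>d. g i * dvar_poly x ^ i)) \<in> dpoly.span (?G \<union> P)"
        by (intro dpoly.span_base UnI2 P_mult g(2))
      ultimately have "(\<Sum>i\<le>d. (h * g i) * dvar_poly x ^ i) +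
          h * (a ^ N * f - (\<Sum>i\<le>d. g i * dvar_poly x ^ i)) \<in> dpoly.span (?G \<union> P)"
        by (rule dpoly.span_add)
      then show ?thesis by (simp add: right_diff_distrib sum_distrib_left mult.assoc)
    qed
    moreover have "h * a ^ N \<notin> P" using h(1) P_power[OF a] P_prime by blast
    moreover have "card ?G \<le> (Suc d * D) * ((c * Suc e) * N) ^ card B"
    proof -
      have "card ?G \<le> card ({..d} \<times> G)" using h(2) by (intro card_image_le) simp
      also have "\<dots> = Suc d * card G" by (simp only: card_cartesian_product card_atMost)
      also have "\<dots> \<le> Suc d * (D * (c * (N * Suc e)) ^ card B)" by (rule mult_le_mono2[OF h(3)])
      also have "\<dots> = (Suc d * D) * ((c * Suc e) * N) ^ card B" by (simp only: mult_ac)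
      finally show ?thesis .
    qed
    moreover have "finite ?G" using h(2) by simp
    ultimately show ?thesis by blast
  qed
  then show ?case by blast
qed

text \<open>The \<open>(N + 1) ^ card S\<close> monomials of the box are linearly independent modulo
  \<open>P\<close>, and stay so after multiplication by \<open>h\<close>, but they land in a space
  whose dimension grows at most like \<open>N ^ card B\<close>.\<close>

lemma indep_card_le:
  assumes "finite B" "finite S" "S \<subseteq> acl B" "indep S"
  shows "card S \<le> card B"
proof (rule ccontr)
  assume less: "\<not> card S \<le> card B"
  obtain A where A: "tri B A" "S \<subseteq> A" using tri_finite[OF assms(2)] acl_tri assms(3) by blast
  obtain c D where cD: "\<And>N. N > 0 \<Longrightarrow> \<exists>h G. h \<notin> P \<and> finite G \<and> card G \<le> D * (c * N) ^ card B \<and>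
    (\<forall>f. dvars f \<subseteq> A \<longrightarrow> degle N f \<longrightarrow> h * f \<in> dpoly.span (G \<union> P))"
    using tri_growth[OF A(1) assms(1)] by blast
  \<comment> \<open>Chosen so that \<open>N ^ Suc (card B)\<close> exceeds the growth bound
    below.\<close>
  define N where "N = D * (c * card S) ^ card B + 1"
  have "N * card S > 0" using less by (simp add: N_def)
  from cD[OF this] obtain h G where h: "h \<notin> P" "finite G" "card G \<le> D * (c * (N * card S)) ^ card B"
    and span: "\<And>f. dvars f \<subseteq> A \<Longrightarrow> degle (N * card S) f \<Longrightarrow> h * f \<in> dpoly.span (G \<union> P)" by blast
  let ?Q = "box S N"
  \<comment> \<open>Splitting off the part in \<open>P\<close> leaves vectors in the span of the
    finite set \<open>G\<close>.\<close>
  have "\<exists>s p. s \<in> dpoly.span G \<and> p \<in> P \<and> h * single m 1 = s + p" if "m \<in> ?Q" for m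
  proof -
    have "h * single m 1 \<in> dpoly.span (G \<union> P)"
      using that A(2) tdeg_box[OF assms(2) that]
      by (intro span degle_single) (auto simp: dvars_single box_def)
    moreover have "dpoly.span P = P" using dpoly.span_eq_iff subspace_P by blast
    ultimately show ?thesis unfolding dpoly.span_Un by auto
  qed
  then obtain s p where sp: "\<And>m. m \<in> ?Q \<Longrightarrow> s m \<in> dpoly.span G \<and> p m \<in> P \<and> h * single m 1 = s m + p m"
    by metis
  \<comment> \<open>A linear relation among the \<open>s m\<close> puts \<open>h * ?f\<close> into
    \<open>P\<close>; as \<open>P\<close> is prime, \<open>?f\<close> lies in \<open>P\<close> and
    vanishes by independence of \<open>S\<close>.\<close>
  have key: "u m = 0" if u: "(\<Sum>m\<in>?Q. dconst (u m) * s m) = 0" and m: "m \<in> ?Q" for u m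
  proof -
    let ?f = "\<Sum>m\<in>?Q. single m (u m)"
    have "h * ?f = (\<Sum>m\<in>?Q. dconst (u m) * (h * single m 1))"
      by (subst single_conv_dconst) (simp only: sum_distrib_left mult_ac)
    also have "\<dots> = (\<Sum>m\<in>?Q. dconst (u m) * s m) + (\<Sum>m\<in>?Q. dconst (u m) * p m)"
      unfolding sum.distrib[symmetric] using sp by (intro sum.cong refl) (simp add: distrib_left)
    also have "\<dots> \<in> P" unfolding u using sp by (auto intro!: P_sum P_mult)
    finally have "?f \<in> P" using h(1) P_prime by blast
    moreover have "dvars ?f \<subseteq> S" by (rule dvars_sum) (auto simp: dvars_single box_def)
    ultimately have "?f = 0" using assms(4) by (simp add: indep_def)
    moreover have "lookup ?f m = u m"
      using m finite_box[OF assms(2)] by (simp add: lookup_sum lookup_single when_def)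
    ultimately show ?thesis by simp
  qed
  have inj: "inj_on s ?Q"
  proof (rule inj_onI, rule ccontr)
    fix m n assume mn: "m \<in> ?Q" "n \<in> ?Q" "s m = s n" "m \<noteq> n"
    let ?u = "\<lambda>i. if i = m then 1 else if i = n then - 1 else 0 :: 'k"
    have "(\<Sum>i\<in>?Q. dconst (?u i) * s i) = (\<Sum>i\<in>{m, n}. dconst (?u i) * s i)"
      using mn finite_box[OF assms(2)] by (intro sum.mono_neutral_right) auto
    also have "\<dots> = 0" using mn by (simp add: single_uminus)
    finally show False using key[of ?u m] mn by simp
  qed
  have "dpoly.independent (s ` ?Q)"
  proof
    assume "dpoly.dependent (s ` ?Q)"
    then obtain u y where u: "y \<in> s ` ?Q" "u y \<noteq> 0" "(\<Sum>v\<in>s ` ?Q. dconst (u v) * v) = 0"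
      using dpoly.dependent_finite[of "s ` ?Q"] finite_box[OF assms(2)] by auto
    then have "(\<Sum>m\<in>?Q. dconst (u (s m)) * s m) = 0" by (simp add: sum.reindex[OF inj])
    from key[OF this] show False using u by auto
  qed
  then have "card (s ` ?Q) \<le> card G"
    using dpoly.independent_span_bound[OF h(2)] sp by blast
  then have "(N + 1) ^ card S \<le> D * (c * (N * card S)) ^ card B"
    using card_image[OF inj] card_box[OF assms(2)] h(3) by simp
  moreover have "N ^ Suc (card B) \<le> (N + 1) ^ card S"
  proof -
    have "N ^ Suc (card B) \<le> (N + 1) ^ Suc (card B)" by (intro power_mono) auto
    also have "\<dots> \<le> (N + 1) ^ card S" using less by (intro power_increasing) auto
    finally show ?thesis .
  qed
  moreover have "D * (c * (N * card S)) ^ card B = (D * (c * card S) ^ card B) * N ^ card B"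
    by (simp add: power_mult_distrib)
  ultimately have "N * N ^ card B \<le> (D * (c * card S) ^ card B) * N ^ card B"
    by (simp only: power_Suc)
  then have "N \<le> D * (c * card S) ^ card B"
    unfolding mult_le_cancel2 by (simp add: N_def)
  then show False by (simp add: N_def)
qed

section \<open>Independence, closure and single relations\<close>

lemma indep_subset: "indep S \<Longrightarrow> T \<subseteq> S \<Longrightarrow> indep T"
  by (auto simp: indep_def)

text \<open>Otherwise the closure of some finite \<open>B\<close> would contain the independent set
  \<open>insert x B\<close>, which is larger than \<open>B\<close>.\<close>

lemma indep_not_acl:
  assumes "indep S" "x \<in> S"
  shows "x \<notin> acl (S - {x})"
proof
  assume "x \<in> acl (S - {x})"
  then obtain B where B: "finite B" "B \<subseteq> S - {x}" "x \<in> acl B" using acl_finite by blast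
  have "card (insert x B) \<le> card B"
    using B assms by (intro indep_card_le) (auto intro: acl.base indep_subset)
  moreover have "x \<notin> B" using B(2) by blast
  ultimately show False using B(1) by simp
qed

text \<open>Although \<open>acl\<close> iterates, a single polynomial over \<open>B\<close>
  witnesses dependence: without one, \<open>insert x B\<close> would be independent.\<close>

lemma acl_relation:
  assumes "x \<in> acl B" "x \<notin> B"
  shows "\<exists>f\<in>P. f \<noteq> 0 \<and> dvars f \<subseteq> insert x B"
proof (rule ccontr)
  assume "\<not> ?thesis"
  then have "indep (insert x B)" by (auto simp: indep_def)
  from indep_not_acl[OF this, of x] show False using assms by simp
qed

text \<open>A relation of minimal total degree has no partial derivative in \<open>P\<close>.\<close>

lemma minimal_relation:
  assumes "f \<in> P" "f \<noteq> 0" "dvars f \<subseteq> S"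
  obtains g where "g \<in> P" "g \<noteq> 0" "dvars g \<subseteq> S" "\<And>v. v \<in> dvars g \<Longrightarrow> pd v g \<notin> P"
proof -
  let ?R = "\<lambda>N. \<exists>g\<in>P. g \<noteq> 0 \<and> dvars g \<subseteq> S \<and> degle N g"
  have "\<exists>N. ?R N" using assms degle_exists[of f] by blast
  define N where "N = (LEAST N. ?R N)"
  have "?R N" unfolding N_def using \<open>\<exists>N. ?R N\<close> by (rule LeastI_ex)
  then obtain g where g: "g \<in> P" "g \<noteq> 0" "dvars g \<subseteq> S" "degle N g" by blast
  have "pd v g \<notin> P" if v: "v \<in> dvars g" for v
  proof
    assume P: "pd v g \<in> P"
    obtain m where "m \<in> keys g" "lookup m v \<noteq> 0" using v by (auto simp: dvars_def in_keys_iff)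
    then have "\<not> degle 0 g" using lookup_le_tdeg[of m v] by (force simp: degle_def)
    then obtain M where M: "N = Suc M" using g(4) by (cases N) auto
    then have "degle M (pd v g)" using g(4) degle_pd by blast
    then have "?R M" using P v g(3) dvars_pd[of v g] pd_nonzero_iff[of v g] by blast
    then have "N \<le> M" unfolding N_def by (rule Least_le)
    then show False using M by simp
  qed
  then show ?thesis using that g by blast
qed

end

section \<open>Rankings\<close>

locale dranking =
  fixes r :: "'n::finite dvar rel"
  assumes ranking: "ranking r"
begin

definition lt :: "'n dvar \<Rightarrow> 'n dvar \<Rightarrow> bool" where
  "lt u v \<longleftrightarrow> (u, v) \<in> r \<and> u \<noteq> v"

lemma le_trans: "(u, v) \<in> r \<Longrightarrow> (v, w) \<in> r \<Longrightarrow> (u, w) \<in> r"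
  and le_antisym: "(u, v) \<in> r \<Longrightarrow> (v, u) \<in> r \<Longrightarrow> u = v"
  and le_refl: "(u, u) \<in> r"
  and le_total: "(u, v) \<in> r \<or> (v, u) \<in> r"
  and le_theta: "(u, theta i u) \<in> r"
  and theta_mono: "(u, v) \<in> r \<Longrightarrow> (theta i u, theta i v) \<in> r"
proof -
  have lin: "refl r" "trans r" "antisym r" "total r"
    using ranking
    by (auto simp: ranking_def linear_order_on_def partial_order_on_def preorder_on_def)
  show "(u, v) \<in> r \<Longrightarrow> (v, w) \<in> r \<Longrightarrow> (u, w) \<in> r" using lin(2) by (meson transD)
  show "(u, v) \<in> r \<Longrightarrow> (v, u) \<in> r \<Longrightarrow> u = v" using lin(3) by (meson antisymD)
  show "(u, u) \<in> r" using lin(1) by (simp add: refl_onD)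
  then show "(u, v) \<in> r \<or> (v, u) \<in> r" using lin(4) by (metis UNIV_I total_on_def)
  show "(u, theta i u) \<in> r" "(u, v) \<in> r \<Longrightarrow> (theta i u, theta i v) \<in> r"
    using ranking unfolding ranking_def by blast+
qed

lemma not_le_iff: "(u, v) \<notin> r \<longleftrightarrow> lt v u"
  unfolding lt_def using le_total le_antisym le_refl by blast

lemma theta_mono2: "(w, u) \<in> r \<Longrightarrow> j \<le> m \<Longrightarrow> (theta j w, theta m u) \<in> r"
  using le_trans[OF theta_mono[of w u j] le_theta[of "theta j u" "m - j"]] by simp

lemma theta_not_le: "i > 0 \<Longrightarrow> (theta i u, u) \<notin> r"
  using le_antisym[OF le_theta[of u i]] theta_left_inject[of i u 0] by auto

text \<open>For a fixed indeterminate the variables increase with their order, so only the finitely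
  many lowest ones in \<open>S\<close> have to be compared.\<close>

lemma ex_least:
  assumes "S \<noteq> {}"
  shows "\<exists>u\<in>S. \<forall>v\<in>S. (u, v) \<in> r"
proof -
  define least where "least t = (t, LEAST j. (t, j) \<in> S)" for t
  have least: "least t \<in> S" "(least t, (t, j)) \<in> r" if "(t, j) \<in> S" for t j
  proof -
    show "least t \<in> S" unfolding least_def using that by (rule LeastI)
    have "snd (least t) \<le> j" unfolding least_def using that by (simp add: Least_le)
    then have "(t, j) = theta (j - snd (least t)) (least t)" by (simp add: theta_def least_def)
    then show "(least t, (t, j)) \<in> r" using le_theta by metis
  qed
  have fin: "\<exists>u\<in>A. \<forall>v\<in>A. (u, v) \<in> r" if "finite A" "A \<noteq> {}" for A
    using that
  proof (induction A rule: finite_ne_induct)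
    case (singleton x)
    then show ?case using le_refl by blast
  next
    case (insert x F)
    then obtain u where "u \<in> F" "\<forall>v\<in>F. (u, v) \<in> r" by blast
    then show ?case using le_total[of u x] le_refl le_trans by blast
  qed
  have "finite (least ` fst ` S)" "least ` fst ` S \<noteq> {}" using assms by simp_all
  then obtain u where u: "u \<in> least ` fst ` S" "\<forall>v\<in>least ` fst ` S. (u, v) \<in> r"
    using fin by blast
  have "(u, v) \<in> r" if "v \<in> S" for v
  proof -
    have "(least (fst v), v) \<in> r" using least(2)[of "fst v" "snd v"] that by simp
    moreover have "(u, least (fst v)) \<in> r" using u(2) that by blast
    ultimately show ?thesis using le_trans by blast
  qed
  moreover from u(1) obtain v where "v \<in> S" "u = least (fst v)" by blast
  then have "u \<in> S" using least(1)[of "fst v" "snd v"] by simp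
  ultimately show ?thesis by blast
qed

lemma wf_lt: "wf {(u, v). lt u v}"
  unfolding wf_eq_minimal
proof (intro allI impI)
  fix Q :: "'n dvar set" and x
  assume "x \<in> Q"
  then obtain u where "u \<in> Q" "\<forall>v\<in>Q. (u, v) \<in> r" using ex_least by blast
  then show "\<exists>z\<in>Q. \<forall>y. (y, z) \<in> {(u, v). lt u v} \<longrightarrow> y \<notin> Q"
    using not_le_iff by blast
qed

lemma wf_rank_less: "wf {(a, b). rank_less r a b}"
proof (rule wf_subset)
  show "wf ({(u, v). lt u v} <*lex*> less_than)" by (intro wf_lex_prod wf_lt wf_less_than)
  show "{(a, b). rank_less r a b} \<subseteq> {(u, v). lt u v} <*lex*> less_than"
    by (auto simp: rank_less_def lt_def)
qed

lemma rank_less_irrefl: "\<not> rank_less r a a"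
  by (simp add: rank_less_def)

lemma rank_less_total: "rank_less r a b \<or> a = b \<or> rank_less r b a"
  unfolding rank_less_def prod_eq_iff using le_total by (metis linorder_neqE_nat)

section \<open>Leaders, reducedness and autoreduced sequences\<close>

lemma leader_in: "f \<notin> range dconst \<Longrightarrow> leader r f \<in> dvars f"
  and leader_ge: "f \<notin> range dconst \<Longrightarrow> v \<in> dvars f \<Longrightarrow> (v, leader r f) \<in> r"
  using leader_greatest[OF ranking] by blast+

lemma leader_eqI:
  assumes "u \<in> dvars f" "\<And>v. v \<in> dvars f \<Longrightarrow> (v, u) \<in> r"
  shows "leader r f = u"
proof -
  have "f \<notin> range dconst" using assms(1) dvars_eq_empty_iff[of f] by auto
  then show ?thesis using assms leader_in leader_ge le_antisym by metis
qed

lemma theta_leader_notin: "f \<notin> range dconst \<Longrightarrow> i > 0 \<Longrightarrow> theta i (leader r f) \<notin> dvars f"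
  using leader_ge theta_not_le by blast

text \<open>Equal leaders are excluded by the degrees, so the leader of \<open>f\<close> and its
  derivatives lie above every variable of \<open>g\<close>.\<close>

lemma reduced_wrt_less:
  assumes "f \<notin> range dconst" "g \<notin> range dconst" "reduced_wrt r f g"
    and "rank_less r (rank r g) (rank r f)"
  shows "reduced_wrt r g f"
proof -
  have l: "lt (leader r g) (leader r f)"
    using assms(3,4) by (auto simp: rank_less_def rank_def lt_def reduced_wrt_def)
  have "theta i (leader r f) \<notin> dvars g" for i
    using l leader_ge[OF assms(2)] le_theta[of "leader r f" i] le_trans not_le_iff by blast
  then show ?thesis
    using deg_in_pos_iff[of "leader r f" f] deg_in_pos_iff[of "leader r f" g] leader_in[OF assms(1)]
      theta_0
    unfolding reduced_wrt_def by (metis gr0I)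
qed

lemma reduced_wrt_cong: "rank r g = rank r g' \<Longrightarrow> reduced_wrt r f g = reduced_wrt r f g'"
  unfolding reduced_wrt_def rank_def by (metis prod.inject)

lemma not_reduced_wrt_rank: "rank r f = rank r g \<Longrightarrow> \<not> reduced_wrt r f g"
  unfolding reduced_wrt_def rank_def by (metis less_irrefl prod.inject)

text \<open>Of two leaders with the same indeterminate one is a derivative of the other, which
  reducedness forbids.\<close>

lemma autoreduced_inj:
  assumes "autoreduced r A"
  shows "inj_on (\<lambda>f. fst (leader r f)) A"
proof -
  have *: "f = g" if "f \<in> A" "g \<in> A" "fst (leader r f) = fst (leader r g)"
    "snd (leader r g) \<le> snd (leader r f)" for f g
  proof (rule ccontr)
    assume "f \<noteq> g"
    then have red: "reduced_wrt r f g" "reduced_wrt r g f"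
      using assms that by (auto simp: autoreduced_def)
    have "leader r f \<in> dvars f"
      using leader_in assms that(1) by (auto simp: autoreduced_def)
    moreover have "leader r f = theta (snd (leader r f) - snd (leader r g)) (leader r g)"
      using theta_of_fst_eq that(3,4) by metis
    ultimately have "snd (leader r f) = snd (leader r g)"
      using red(1) that(4) unfolding reduced_wrt_def by (metis le_neq_implies_less zero_less_diff)
    then have "leader r f = leader r g" using that(3) by (simp add: prod_eq_iff)
    then show False using red by (auto simp: reduced_wrt_def)
  qed
  show ?thesis by (rule inj_onI) (metis * nle_le)
qed

lemma autoreduced_seq_nth:
  assumes "autoreduced_seq r A" "i < j" "j < length A"
  shows "rank_less r (rank r (A ! i)) (rank r (A ! j))" "A ! i \<noteq> A ! j" "reduced_wrt r (A ! j) (A ! i)"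
proof -
  show l: "rank_less r (rank r (A ! i)) (rank r (A ! j))"
    using assms sorted_wrt_nth_less[of "\<lambda>f g. rank_less r (rank r f) (rank r g)" A i j]
    by (simp add: autoreduced_seq_def)
  then show "A ! i \<noteq> A ! j" using rank_less_irrefl by metis
  then show "reduced_wrt r (A ! j) (A ! i)"
    using assms by (simp add: autoreduced_seq_def autoreduced_def)
qed

lemma autoreduced_seq_distinct: "autoreduced_seq r A \<Longrightarrow> distinct A"
  unfolding distinct_conv_nth using autoreduced_seq_nth(2) by (metis linorder_neqE_nat)

lemma autoreduced_seq_length:
  assumes "autoreduced_seq r A"
  shows "length A \<le> card (UNIV :: 'n set)"
proof -
  have "inj_on (\<lambda>f. fst (leader r f)) (set A)"
    using assms by (simp add: autoreduced_seq_def autoreduced_inj)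
  then have "card (set A) \<le> card (UNIV :: 'n set)" by (rule card_inj_on_le) auto
  then show ?thesis using autoreduced_seq_distinct[OF assms] by (simp add: distinct_card)
qed

lemma autoreduced_seq_snoc:
  assumes A: "autoreduced_seq r A" and f: "f \<notin> range dconst" "\<And>g. g \<in> set A \<Longrightarrow> reduced_wrt r f g"
    and less: "\<And>g. g \<in> set A \<Longrightarrow> rank_less r (rank r g) (rank r f)"
  shows "autoreduced_seq r (A @ [f])"
proof -
  have "reduced_wrt r g f" if "g \<in> set A" for g
  proof -
    have "g \<notin> range dconst" using A that unfolding autoreduced_seq_def autoreduced_def by blast
    then show ?thesis using f(2)[OF that] less[OF that] by (rule reduced_wrt_less[OF f(1)])
  qed
  moreover have "autoreduced r (set A)" "sorted_wrt (\<lambda>f g. rank_less r (rank r f) (rank r g)) A"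
    using A by (auto simp: autoreduced_seq_def)
  ultimately have "autoreduced r (insert f (set A))"
    using f unfolding autoreduced_def by blast
  then show ?thesis
    using \<open>sorted_wrt _ A\<close> less by (simp add: autoreduced_seq_def sorted_wrt_append)
qed

text \<open>Greedy construction: always append an element of lowest rank among those reduced with
  respect to the previous ones. The number of indeterminates bounds the length, so a longest such
  sequence exists.\<close>

lemma ex_characteristic_set: "\<exists>C. characteristic_set r I C"
proof -
  define greedy where "greedy C \<longleftrightarrow> autoreduced_seq r C \<and> set C \<subseteq> I \<and>
    (\<forall>i<length C. \<forall>f\<in>I. f \<notin> range dconst \<longrightarrow> (\<forall>j<i. reduced_wrt r f (C ! j)) \<longrightarrow>
      \<not> rank_less r (rank r f) (rank r (C ! i)))" for C
  have "greedy []" by (simp add: greedy_def autoreduced_seq_def autoreduced_def)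
  moreover have "\<forall>C. greedy C \<longrightarrow> length C < Suc (card (UNIV :: 'n set))"
    by (auto simp: greedy_def less_Suc_eq_le intro: autoreduced_seq_length)
  ultimately obtain C where C: "greedy C" "\<And>D. greedy D \<Longrightarrow> length D \<le> length C"
    using ex_has_greatest_nat[of greedy "[]" length "Suc (card (UNIV :: 'n set))"] by blast
  \<comment> \<open>A further reduced element, taken of minimal rank, would extend the longest
    greedy sequence.\<close>
  have max: "f \<in> range dconst" if f: "f \<in> I" "\<And>g. g \<in> set C \<Longrightarrow> reduced_wrt r f g" for f
  proof (rule ccontr)
    assume nc: "f \<notin> range dconst"
    let ?Q = "{f \<in> I. f \<notin> range dconst \<and> (\<forall>g\<in>set C. reduced_wrt r f g)}"
    have "wf (inv_image {(a, b). rank_less r a b} (rank r))" using wf_rank_less by (rule wf_inv_image)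
    moreover have "f \<in> ?Q" using f nc by blast
    ultimately obtain m where m: "m \<in> ?Q" "\<And>g. rank_less r (rank r g) (rank r m) \<Longrightarrow> g \<notin> ?Q"
      by (rule wfE_min) auto
    have less: "rank_less r (rank r g) (rank r m)" if g: "g \<in> set C" for g
    proof -
      obtain i where i: "i < length C" "g = C ! i" using g by (auto simp: in_set_conv_nth)
      then have "\<not> rank_less r (rank r m) (rank r g)" using C(1) m(1) by (auto simp: greedy_def)
      moreover have "rank r m \<noteq> rank r g" using m(1) g not_reduced_wrt_rank by blast
      ultimately show ?thesis using rank_less_total by metis
    qed
    have "greedy (C @ [m])"
      unfolding greedy_def
    proof (intro conjI allI ballI impI)
      show "autoreduced_seq r (C @ [m])"
        using C(1) m(1) less by (intro autoreduced_seq_snoc) (auto simp: greedy_def)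
      show "set (C @ [m]) \<subseteq> I" using C(1) m(1) by (auto simp: greedy_def)
      fix i f assume i: "i < length (C @ [m])" and f: "f \<in> I" "f \<notin> range dconst"
        and red: "\<forall>j<i. reduced_wrt r f ((C @ [m]) ! j)"
      show "\<not> rank_less r (rank r f) (rank r ((C @ [m]) ! i))"
      proof (cases "i < length C")
        case True
        then show ?thesis using C(1) f red by (auto simp: greedy_def nth_append)
      next
        case False
        then have "i = length C" using i by simp
        then have "f \<in> ?Q" using f red by (auto simp: in_set_conv_nth nth_append)
        then show ?thesis using m(2) \<open>i = length C\<close> by (auto simp: nth_append)
      qed
    qed
    from C(2)[OF this] show False by simp
  qed
  \<comment> \<open>At the first difference the element of \<open>B\<close> would have been a better
    greedy choice; if \<open>B\<close> merely continues \<open>C\<close>, its next element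
    contradicts \<open>max\<close>.\<close>
  have "\<not> lower_rank r B C" if B: "autoreduced_seq r B" "set B \<subseteq> I" for B
  proof
    have B': "B ! j \<in> I" "B ! j \<notin> range dconst" if "j < length B" for j
      using B nth_mem[OF that] unfolding autoreduced_seq_def autoreduced_def by blast+
    have red: "reduced_wrt r (B ! j) (C ! i)"
      if "i < j" "j < length B" "rank r (B ! i) = rank r (C ! i)" for i j
      using autoreduced_seq_nth(3)[OF B(1) that(1,2)] reduced_wrt_cong[OF that(3)] by blast
    assume "lower_rank r B C"
    then consider j where "j < length B" "j < length C" "\<forall>i<j. rank r (B ! i) = rank r (C ! i)"
        "rank_less r (rank r (B ! j)) (rank r (C ! j))"
      | "length B > length C" "\<forall>i<length C. rank r (B ! i) = rank r (C ! i)"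
      unfolding lower_rank_def by blast
    then show False
    proof cases
      case (1 j)
      then show False using C(1) B'[of j] red[of _ j] by (auto simp: greedy_def)
    next
      case 2
      then show False
        using max[OF B'(1)[of "length C"]] B'(2)[of "length C"] red[of _ "length C"]
        by (auto simp: in_set_conv_nth)
    qed
  qed
  then show ?thesis using C(1) by (auto simp: characteristic_set_def greedy_def)
qed

text \<open>Keep the elements of rank below that of \<open>f\<close>, append \<open>f\<close> and
  drop the rest: the result would have lower rank than \<open>C\<close>.\<close>

lemma characteristic_set_not_reduced:
  assumes C: "characteristic_set r I C" and f: "f \<in> I" "f \<notin> range dconst"
    and red: "\<And>g. g \<in> set C \<Longrightarrow> reduced_wrt r f g"
  shows False
proof -
  let ?B = "takeWhile (\<lambda>g. rank_less r (rank r g) (rank r f)) C"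
  let ?n = "length ?B"
  have A: "autoreduced_seq r C" "set C \<subseteq> I" using C by (auto simp: characteristic_set_def)
  have B: "?B = take ?n C" by (rule takeWhile_eq_take)
  have sub: "set ?B \<subseteq> set C" by (rule set_takeWhileD[THEN conjunct1, THEN subsetI])
  have "sorted_wrt (\<lambda>f g. rank_less r (rank r f) (rank r g)) ?B"
    using A(1) by (subst B, unfold autoreduced_seq_def) (blast intro: sorted_wrt_take)
  then have "autoreduced_seq r ?B"
    using A(1) sub by (auto simp: autoreduced_seq_def autoreduced_def)
  then have seq: "autoreduced_seq r (?B @ [f])"
    using f(2) red sub by (intro autoreduced_seq_snoc) (auto dest: set_takeWhileD)
  have "lower_rank r (?B @ [f]) C"
  proof (cases "?n < length C")
    case True
    then have "\<not> rank_less r (rank r (C ! ?n)) (rank r f)" by (rule nth_length_takeWhile)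
    moreover have "rank r f \<noteq> rank r (C ! ?n)" using True red[of "C ! ?n"] not_reduced_wrt_rank by auto
    ultimately have "rank_less r (rank r f) (rank r (C ! ?n))" using rank_less_total by metis
    then show ?thesis
      unfolding lower_rank_def using True
      by (intro disjI1 exI[of _ ?n] conjI allI impI) (simp_all add: nth_append takeWhile_nth)
  next
    case False
    then have "?n = length C" using length_takeWhile_le[of "\<lambda>g. rank_less r (rank r g) (rank r f)" C] by simp
    then have "?B = C" by (subst B) simp
    show ?thesis unfolding lower_rank_def \<open>?B = C\<close> by (intro disjI2) (simp add: nth_append)
  qed
  then show False
    using C seq f(1) A(2) sub unfolding characteristic_set_def by auto
qed

lemma characteristic_set_same_ranks:
  assumes C: "characteristic_set r I C" and C': "autoreduced_seq r C'" "set C' \<subseteq> I"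
    and ranks: "map (rank r) C' = map (rank r) C"
  shows "characteristic_set r I C'"
proof -
  have l: "length C' = length C" using ranks by (rule map_eq_imp_length_eq)
  have "rank r (C' ! i) = rank r (C ! i)" if "i < length C" for i
    using ranks l that by (metis nth_map)
  then have "lower_rank r B C' \<longleftrightarrow> lower_rank r B C" for B
    unfolding lower_rank_def l by (intro arg_cong2[where f = disj] ex_cong1 conj_cong refl) auto
  then show ?thesis using C C' by (simp add: characteristic_set_def)
qed

end

section \<open>Leaders of a characteristic set\<close>

definition ord_le :: "nat \<Rightarrow> 'n dvar set" where
  "ord_le s = {v. snd v \<le> s}"

lemma ord_le_conv: "ord_le s = UNIV \<times> {..s}"
  by (auto simp: ord_le_def)

lemma finite_ord_le: "finite (ord_le s :: 'n::finite dvar set)"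
  and card_ord_le: "card (ord_le s :: 'n::finite dvar set) = card (UNIV :: 'n set) * (s + 1)"
  by (simp_all add: ord_le_conv card_cartesian_product)

locale charset = prime_dideal \<delta> P + dranking r
  for \<delta> :: "'k::field_char_0 \<Rightarrow> 'k" and P :: "('n::finite, 'k) dpoly set" and r :: "'n dvar rel" +
  fixes C :: "('n, 'k) dpoly list"
  assumes charset: "characteristic_set r P C"
begin

definition leaders :: "'n dvar set" where
  "leaders = leader r ` set C"

text \<open>The parametric variables; \<open>indep_par\<close> and \<open>acl_par\<close> make them
  a transcendence basis modulo \<open>P\<close>.\<close>

definition par :: "'n dvar set" where
  "par = {v. \<forall>m. \<forall>u\<in>leaders. v \<noteq> theta m u}"

lemma finite_leaders: "finite leaders"
  by (simp add: leaders_def)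

lemma C_autoreduced: "autoreduced_seq r C" "autoreduced r (set C)" "set C \<subseteq> P"
  using charset by (auto simp: characteristic_set_def autoreduced_seq_def)

lemma C_not_const: "g \<in> set C \<Longrightarrow> g \<notin> range dconst"
  using C_autoreduced(2) by (auto simp: autoreduced_def)

lemma leaders_inj: "inj_on fst leaders"
  using autoreduced_inj[OF C_autoreduced(2)] by (auto simp: leaders_def inj_on_def)

lemma inj_leader: "inj_on (leader r) (set C)"
  using autoreduced_inj[OF C_autoreduced(2)] by (auto simp: inj_on_def)

lemma reduced_eq_0:
  assumes "f \<in> P" "\<And>g. g \<in> set C \<Longrightarrow> reduced_wrt r f g"
  shows "f = 0"
  using characteristic_set_not_reduced[OF charset assms(1)] assms P_not_const by blast

text \<open>The separant is reduced with respect to all of \<open>C\<close>. Lying in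
  \<open>P\<close> it would be zero, but in characteristic zero it is not.\<close>

lemma separant:
  assumes g: "g \<in> set C"
  shows "pd (leader r g) g \<notin> P"
proof
  let ?u = "leader r g"
  assume P: "pd ?u g \<in> P"
  have nc: "g \<notin> range dconst" using g by (rule C_not_const)
  have u: "?u \<in> dvars g" using nc by (rule leader_in)
  have "reduced_wrt r (pd ?u g) g'" if g': "g' \<in> set C" for g'
  proof (cases "g' = g")
    case True
    then show ?thesis
      using theta_leader_notin[OF nc] dvars_pd[of ?u g] deg_in_pd_less[OF u]
      by (auto simp: reduced_wrt_def)
  next
    case False
    then have "reduced_wrt r g g'" using C_autoreduced(2) g g' by (auto simp: autoreduced_def)
    then show ?thesis
      unfolding reduced_wrt_def using dvars_pd[of ?u g] deg_in_pd[of "leader r g'" ?u g]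
      by (meson le_less_trans subsetD)
  qed
  then have "pd ?u g = 0" using P by (rule reduced_eq_0[rotated])
  then show False using u pd_nonzero_iff by blast
qed

text \<open>A polynomial in parametric variables is reduced with respect to every element of
  \<open>C\<close>, as no derivative of a leader occurs in it.\<close>

lemma indep_par: "indep par"
  unfolding indep_def
proof (intro ballI impI)
  fix f assume f: "f \<in> P" "dvars f \<subseteq> par"
  show "f = 0"
  proof (rule reduced_eq_0[OF f(1)])
    fix g assume g: "g \<in> set C"
    then have "theta i (leader r g) \<notin> par" for i by (auto simp: par_def leaders_def)
    then have n: "theta i (leader r g) \<notin> dvars f" for i using f(2) by blast
    have "deg_in (leader r g) f = 0" using n[of 0] deg_in_pos_iff[of "leader r g" f] by simp
    moreover have "deg_in (leader r g) g > 0"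
      using deg_in_pos_iff leader_in C_not_const[OF g] by blast
    ultimately show "reduced_wrt r f g" using n by (simp add: reduced_wrt_def)
  qed
qed

end

context prime_dideal
begin

text \<open>Differentiating a relation \<open>m\<close> times gives a relation that is linear in \<open>theta m v\<close>, with
  leading coefficient \<open>pd v f\<close>.\<close>

lemma acl_theta:
  assumes f: "f \<in> P" "pd v f \<notin> P" "\<And>i. i > 0 \<Longrightarrow> theta i v \<notin> dvars f"
    and B: "\<And>j w. j \<le> m \<Longrightarrow> w \<in> dvars f \<Longrightarrow> theta j w \<noteq> theta m v \<Longrightarrow> theta j w \<in> acl B"
  shows "theta m v \<in> acl B"
proof (rule aclI_pd)
  show "(dpoly_deriv \<delta> ^^ m) f \<in> P" using f(1) by (rule P_deriv_pow)
  show "pd (theta m v) ((dpoly_deriv \<delta> ^^ m) f) \<notin> P"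
    using f(2) pd_dpoly_deriv_pow[OF derivation f(3)] by simp
  show "dvars ((dpoly_deriv \<delta> ^^ m) f) \<subseteq> insert (theta m v) (acl B)"
    using dvars_dpoly_deriv_pow[where \<delta> = \<delta> and m = m and f = f] B by blast
qed

end

context charset
begin

text \<open>Well-founded induction along the ranking: derivatives of leaders are eliminated one by one.\<close>

lemma acl_elim:
  assumes par: "\<And>v. v \<in> A \<Longrightarrow> (\<nexists>m u. v = theta m u \<and> u \<in> leaders \<and> m \<le> s m u) \<Longrightarrow> v \<in> acl B"
    and A: "\<And>g m j w. g \<in> set C \<Longrightarrow> theta m (leader r g) \<in> A \<Longrightarrow> m \<le> s m (leader r g) \<Longrightarrow>
      j \<le> m \<Longrightarrow> w \<in> dvars g \<Longrightarrow> theta j w \<in> A"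
  shows "v \<in> A \<Longrightarrow> v \<in> acl B"
  using wf_lt
proof (induction v rule: wf_induct_rule)
  case (less v)
  show ?case
  proof (cases "\<exists>m u. v = theta m u \<and> u \<in> leaders \<and> m \<le> s m u")
    case True
    then obtain m g where g: "g \<in> set C" and v: "v = theta m (leader r g)" "m \<le> s m (leader r g)"
      by (auto simp: leaders_def)
    have nc: "g \<notin> range dconst" using g by (rule C_not_const)
    show ?thesis unfolding v(1)
    proof (rule acl_theta)
      show "g \<in> P" "pd (leader r g) g \<notin> P" using g C_autoreduced(3) separant by auto
      show "\<And>i. i > 0 \<Longrightarrow> theta i (leader r g) \<notin> dvars g" using theta_leader_notin[OF nc] .
      fix j w assume jw: "j \<le> m" "w \<in> dvars g" "theta j w \<noteq> theta m (leader r g)"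
      have "lt (theta j w) v"
        unfolding v(1) lt_def using theta_mono2[OF leader_ge[OF nc jw(2)] jw(1)] jw(3) by blast
      moreover have "theta j w \<in> A" using A[OF g] less(2) v jw(1,2) by blast
      ultimately show "theta j w \<in> acl B" using less(1) by blast
    qed
  next
    case False
    then show ?thesis using par less(2) by blast
  qed
qed

text \<open>\<open>s m u = m\<close> means that all derivatives of leaders are eliminated. The
  initial segment up to \<open>v\<close> contains every variable arising on the way.\<close>

lemma acl_par: "v \<in> acl {w \<in> par. (w, v) \<in> r}"
proof (rule acl_elim[where A = "{w. (w, v) \<in> r}" and s = "\<lambda>m u. m"])
  fix g m j w
  assume g: "g \<in> set C" "theta m (leader r g) \<in> {w. (w, v) \<in> r}" "j \<le> m" "w \<in> dvars g"
  then have "(theta j w, theta m (leader r g)) \<in> r"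
    using leader_ge C_not_const theta_mono2 by blast
  then show "theta j w \<in> {w. (w, v) \<in> r}" using g(2) le_trans by blast
qed (auto simp: le_refl par_def intro: acl.base)

section \<open>Orders of leaders and counting of variables\<close>

definition lead_ord :: nat where
  "lead_ord = (\<Sum>u\<in>leaders. snd u)"

lemma snd_leader_le: "u \<in> leaders \<Longrightarrow> snd u \<le> lead_ord"
  unfolding lead_ord_def using finite_leaders by (rule member_le_sum[rotated 2]) auto

lemma card_theta_leaders:
  "card ((\<lambda>(m, u). theta m u) ` (SIGMA m : {..s}. leaders)) = card leaders * (s + 1)"
proof -
  have "inj_on (\<lambda>(m, u). theta m u) (SIGMA m : {..s}. leaders)"
  proof (rule inj_onI, clarsimp)
    fix m a b m' a' b'
    assume "(a, b) \<in> leaders" "(a', b') \<in> leaders" "theta m (a, b) = theta m' (a', b')"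
    moreover from this have "a = a'" by (simp add: theta_def)
    ultimately have "(a, b) = (a', b')" using inj_onD[OF leaders_inj, of "(a, b)" "(a', b')"] by simp
    then show "m = m' \<and> a = a' \<and> b = b'" using \<open>theta m (a, b) = theta m' (a', b')\<close> by auto
  qed
  then show ?thesis by (simp add: card_image card_cartesian_product)
qed

text \<open>An upper bound for transcendence degrees under any ranking. If \<open>c\<close> bounds
  the orders in \<open>C\<close>, then \<open>theta m u\<close> with \<open>m \<le> s\<close> can be
  eliminated for each leader \<open>u\<close> without exceeding order \<open>s + c\<close>.\<close>

lemma elim_bounded:
  "\<exists>c. \<forall>s. \<exists>B \<subseteq> ord_le (s + c). ord_le (s + c) \<subseteq> acl B \<and>
    card B + card leaders * (s + 1) = card (UNIV :: 'n set) * (s + c + 1)"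
proof -
  have "finite (\<Union>g\<in>set C. snd ` dvars g)" by (simp add: finite_dvars)
  then obtain c where c: "\<And>g w. g \<in> set C \<Longrightarrow> w \<in> dvars g \<Longrightarrow> snd w \<le> c"
    unfolding finite_nat_set_iff_bounded_le by blast
  have "\<exists>B \<subseteq> ord_le (s + c). ord_le (s + c) \<subseteq> acl B \<and>
    card B + card leaders * (s + 1) = card (UNIV :: 'n set) * (s + c + 1)" for s
  proof -
    let ?L = "(\<lambda>(m, u). theta m u) ` (SIGMA m : {..s}. leaders)"
    have sc: "snd u \<le> c" if u: "u \<in> leaders" for u
    proof -
      obtain g where g: "g \<in> set C" "u = leader r g" using u by (auto simp: leaders_def)
      then show ?thesis using c leader_in[OF C_not_const[OF g(1)]] by blast
    qed
    have L: "?L \<subseteq> ord_le (s + c)"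
    proof
      fix v assume "v \<in> ?L"
      then obtain m u where "m \<le> s" "u \<in> leaders" "v = theta m u" by auto
      then show "v \<in> ord_le (s + c)" using sc[of u] by (simp add: ord_le_def)
    qed
    have "v \<in> acl (ord_le (s + c) - ?L)" if "v \<in> ord_le (s + c)" for v
    proof (rule acl_elim[where A = "ord_le (s + c)" and s = "\<lambda>m u. s", OF _ _ that])
      fix v assume "v \<in> ord_le (s + c)" "\<nexists>m u. v = theta m u \<and> u \<in> leaders \<and> m \<le> s"
      then show "v \<in> acl (ord_le (s + c) - ?L)" by (intro acl.base) auto
    next
      fix g m j w assume "g \<in> set C" "m \<le> s" "j \<le> m" "w \<in> dvars g"
      then show "theta j w \<in> ord_le (s + c)" using c[of g w] by (simp add: ord_le_def)
    qed
    moreover have "card (ord_le (s + c) - ?L) + card leaders * (s + 1) = card (UNIV :: 'n set) * (s + c + 1)"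
      using card_Diff_subset[of ?L "ord_le (s + c)"] card_mono[OF finite_ord_le L] L finite_leaders
      by (simp add: card_theta_leaders card_ord_le)
    ultimately show ?thesis by (intro exI[of _ "ord_le (s + c) - ?L"]) auto
  qed
  then show ?thesis by blast
qed

text \<open>Each leader \<open>u\<close> removes its \<open>s + 1 - snd u\<close> derivatives of
  order at most \<open>s\<close>, and different leaders belong to different indeterminates.\<close>

lemma card_par_ord_le:
  assumes "\<And>u. u \<in> leaders \<Longrightarrow> snd u \<le> s"
  shows "card (ord_le s \<inter> par) + card leaders * (s + 1) = card (UNIV :: 'n set) * (s + 1) + lead_ord"
proof -
  let ?L = "\<lambda>u. (\<lambda>m. theta m u) ` {..s - snd u}"
  have split: "ord_le s = (ord_le s \<inter> par) \<union> (\<Union>u\<in>leaders. ?L u)"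
  proof
    show "ord_le s \<subseteq> (ord_le s \<inter> par) \<union> (\<Union>u\<in>leaders. ?L u)"
      by (force simp: ord_le_def par_def theta_def)
    show "(ord_le s \<inter> par) \<union> (\<Union>u\<in>leaders. ?L u) \<subseteq> ord_le s"
      using assms by (auto simp: ord_le_def theta_def) (metis Nat.le_diff_conv2 add.commute snd_conv)
  qed
  have "card (ord_le s :: 'n dvar set) = card ((ord_le s \<inter> par) \<union> (\<Union>u\<in>leaders. ?L u))"
    using split by (rule arg_cong)
  also have "\<dots> = card (ord_le s \<inter> par) + card (\<Union>u\<in>leaders. ?L u)"
    by (rule card_Un_disjoint) (auto simp: par_def finite_ord_le finite_leaders)
  also have "card (\<Union>u\<in>leaders. ?L u) = (\<Sum>u\<in>leaders. card (?L u))"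
  proof (rule card_UN_disjoint[OF finite_leaders])
    show "\<forall>u\<in>leaders. \<forall>v\<in>leaders. u \<noteq> v \<longrightarrow> ?L u \<inter> ?L v = {}"
      using leaders_inj by (auto simp: theta_def dest: inj_onD)
  qed simp
  also have "\<dots> = (\<Sum>u\<in>leaders. s + 1 - snd u)"
    using assms by (intro sum.cong refl) (simp add: card_image inj_on_def Suc_diff_le)
  finally have "card (ord_le s :: 'n dvar set) = card (ord_le s \<inter> par) + (\<Sum>u\<in>leaders. s + 1 - snd u)" .
  moreover have "(\<Sum>u\<in>leaders. s + 1 - snd u) + lead_ord = card leaders * (s + 1)"
    unfolding lead_ord_def sum.distrib[symmetric] using assms by (simp add: trans_le_add1 le_SucI)
  ultimately show ?thesis by (simp add: card_ord_le)
qed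

text \<open>The parametric variables split into those of indeterminates without leader, cut off here
  at order \<open>s\<close>, and the finitely many below a leader, collected in
  \<open>low\<close>.\<close>

definition free :: "nat \<Rightarrow> 'n dvar set" where
  "free s = (- fst ` leaders) \<times> {..s}"

definition low :: "'n dvar set" where
  "low = (\<Union>u\<in>leaders. {fst u} \<times> {..<snd u})"

lemma free_par: "free s \<subseteq> par"
  by (auto simp: free_def par_def theta_def)

lemma low_par: "low \<subseteq> par"
proof
  fix v assume "v \<in> low"
  then obtain u where u: "u \<in> leaders" "fst v = fst u" "snd v < snd u" by (auto simp: low_def)
  show "v \<in> par"
    unfolding par_def mem_Collect_eq
  proof (intro allI ballI notI)
    fix m u' assume "u' \<in> leaders" "v = theta m u'"
    then show False using u leaders_inj by (auto dest: inj_onD)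
  qed
qed

lemma par_cases:
  assumes "v \<in> par"
  shows "fst v \<notin> fst ` leaders \<or> v \<in> low"
proof (rule disjCI)
  assume "v \<notin> low"
  show "fst v \<notin> fst ` leaders"
  proof
    assume "fst v \<in> fst ` leaders"
    then obtain u where u: "u \<in> leaders" "fst u = fst v" by auto
    then have "snd u \<le> snd v" using \<open>v \<notin> low\<close> by (force simp: low_def mem_Times_iff)
    then show False using assms u theta_of_fst_eq[of u v] by (auto simp: par_def)
  qed
qed

lemma finite_free: "finite (free s)"
  by (simp add: free_def)

lemma card_free: "card (free s) + card leaders * (s + 1) = card (UNIV :: 'n set) * (s + 1)"
proof -
  have "card (- fst ` leaders) + card leaders = card (UNIV :: 'n set)"
    using card_image[OF leaders_inj] card_mono[of UNIV "fst ` leaders"]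
    by (simp add: Compl_eq_Diff_UNIV card_Diff_subset)
  then show ?thesis
    by (simp only: free_def card_cartesian_product card_atMost Suc_eq_plus1 flip: add_mult_distrib)
qed

lemma finite_low: "finite low"
  by (simp add: low_def finite_leaders)

lemma card_low: "card low = lead_ord"
proof -
  have "card low = (\<Sum>u\<in>leaders. card ({fst u} \<times> {..<snd u}))"
    unfolding low_def
    by (rule card_UN_disjoint[OF finite_leaders]) (use leaders_inj in \<open>auto dest: inj_onD\<close>)
  then show ?thesis by (simp add: lead_ord_def card_cartesian_product)
qed

lemma free_low_disjoint: "free s \<inter> low = {}"
  by (auto simp: free_def low_def)

lemma low_ord_le: "low \<subseteq> ord_le lead_ord"
  using snd_leader_le by (fastforce simp: low_def ord_le_def)

end

section \<open>Orders of characteristic sets\<close>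

context charset
begin

text \<open>Below a variable, an orderly ranking has only variables of at most its order, so
  \<open>acl_par\<close> stays within order \<open>s\<close>.\<close>

lemma acl_orderly:
  assumes "orderly r"
  shows "ord_le s \<subseteq> acl (ord_le s \<inter> par)"
proof
  fix v :: "'n dvar"
  assume v: "v \<in> ord_le s"
  have "snd w \<le> snd v" if "(w, v) \<in> r" for w
    using that assms le_antisym unfolding orderly_def by (meson not_le)
  then have "{w \<in> par. (w, v) \<in> r} \<subseteq> ord_le s \<inter> par" using v by (force simp: ord_le_def)
  then show "v \<in> acl (ord_le s \<inter> par)" using acl_par acl_mono by blast
qed

text \<open>The leader for an orderly ranking has the order of its polynomial; thus
  \<open>lead_ord\<close> is then the order of \<open>P\<close>.\<close>

lemma lead_ord_orderly:
  assumes "orderly r"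
  shows "lead_ord = (\<Sum>f\<leftarrow>C. dord f)"
proof -
  have "snd (leader r f) = dord f" if "f \<in> set C" for f
  proof -
    have nc: "f \<notin> range dconst" using that by (rule C_not_const)
    have "snd v \<le> snd (leader r f)" if "v \<in> dvars f" for v
      using leader_ge[OF nc that] assms le_antisym unfolding orderly_def by (meson not_le)
    then show ?thesis unfolding dord_def
      using leader_in[OF nc] by (intro Max_eqI[symmetric]) (auto simp: finite_dvars)
  qed
  then have "lead_ord = (\<Sum>f\<in>set C. dord f)"
    unfolding lead_ord_def leaders_def by (simp add: sum.reindex[OF inj_leader])
  also have "\<dots> = (\<Sum>f\<leftarrow>C. dord f)"
    using autoreduced_seq_distinct[OF C_autoreduced(1)] by (simp add: sum_list_distinct_conv_sum_set)
  finally show ?thesis .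
qed

text \<open>By minimal degree no partial derivative lies in \<open>P\<close>, so the relation can
  later be solved for any of its variables. Independence of \<open>par\<close> forces
  \<open>u\<close> to occur.\<close>

lemma leader_relation:
  assumes u: "u \<in> leaders"
  shows "\<exists>f\<in>P. u \<in> dvars f \<and> dvars f \<subseteq> insert u par \<and> (\<forall>v\<in>dvars f. (v, u) \<in> r \<and> pd v f \<notin> P)"
proof -
  have "u \<notin> par" using u unfolding par_def by (metis (mono_tags, lifting) mem_Collect_eq theta_0)
  then obtain f0 where f0: "f0 \<in> P" "f0 \<noteq> 0" "dvars f0 \<subseteq> insert u {w \<in> par. (w, u) \<in> r}"
    using acl_relation[OF acl_par, of u] by blast
  obtain f where f: "f \<in> P" "f \<noteq> 0" "dvars f \<subseteq> insert u {w \<in> par. (w, u) \<in> r}"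
    "\<And>v. v \<in> dvars f \<Longrightarrow> pd v f \<notin> P" using minimal_relation[OF f0] by blast
  have "u \<in> dvars f"
  proof (rule ccontr)
    assume "u \<notin> dvars f"
    then have "dvars f \<subseteq> par" using f(3) by blast
    then show False using indep_par f(1,2) by (simp add: indep_def)
  qed
  then show ?thesis using f le_refl by blast
qed

text \<open>Compare growth in \<open>s\<close>: the free variables of \<open>D\<close> are
  independent, and \<open>elim_bounded\<close> for \<open>C\<close> limits their number.\<close>

lemma card_leaders_le:
  assumes "charset \<delta> P r' D"
  shows "card leaders \<le> card (charset.leaders r' D)"
proof -
  interpret D: charset \<delta> P r' D by fact
  let ?l = "card (UNIV :: 'n set)" and ?p = "card D.leaders" and ?p' = "card leaders"
  obtain c where c: "\<And>s. \<exists>B \<subseteq> ord_le (s + c). ord_le (s + c) \<subseteq> acl B \<and>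
    card B + ?p' * (s + 1) = ?l * (s + c + 1)" using elim_bounded by blast
  \<comment> \<open>One leader more would contribute \<open>s + 1\<close>, just above the error term
    \<open>?p * c\<close>.\<close>
  define s where "s = ?p * c"
  obtain B where B: "B \<subseteq> ord_le (s + c)" "ord_le (s + c) \<subseteq> acl B"
      "card B + ?p' * (s + 1) = ?l * (s + c + 1)" using c by blast
  have "D.free (s + c) \<subseteq> ord_le (s + c)" by (auto simp: D.free_def ord_le_def)
  then have "card (D.free (s + c)) \<le> card B"
    using B D.free_par D.finite_free finite_subset[OF B(1) finite_ord_le]
    by (intro indep_card_le indep_subset[OF D.indep_par]) auto
  then have le: "?p' * (s + 1) \<le> ?p * (s + c + 1)" using D.card_free[of "s + c"] B(3) by simp
  show ?thesis
  proof (rule ccontr)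
    assume "\<not> ?p' \<le> ?p"
    then have "Suc ?p * (s + 1) \<le> ?p' * (s + 1)" by (intro mult_le_mono1) simp
    then show False using le by (simp add: s_def algebra_simps)
  qed
qed

end

text \<open>The characteristic set \<open>D\<close> for an orderly ranking computes the transcendence degree of
  \<open>ord_le s\<close> over \<open>k\<close>; \<open>C\<close> is a characteristic set for an arbitrary ranking.\<close>

locale charset_pair = charset \<delta> P r C + D: charset \<delta> P r' D
  for \<delta> :: "'k::field_char_0 \<Rightarrow> 'k" and P :: "('n::finite, 'k) dpoly set"
    and r r' :: "'n dvar rel" and C D +
  assumes orderly: "orderly r'"
begin

lemma card_orderly_basis:
  assumes "D.lead_ord \<le> s"
  shows "card (ord_le s \<inter> D.par) \<le> card (free s) + D.lead_ord"
proof -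
  have "card (ord_le s \<inter> D.par) + card D.leaders * (s + 1) = card (UNIV :: 'n set) * (s + 1) + D.lead_ord"
    using D.snd_leader_le assms order_trans by (intro D.card_par_ord_le) blast
  moreover have "card leaders * (s + 1) \<le> card D.leaders * (s + 1)"
    by (intro mult_le_mono1 card_leaders_le D.charset_axioms)
  ultimately show ?thesis using card_free[of s] by simp
qed

text \<open>\<open>free s\<close> and \<open>low\<close> are jointly independent, so the orderly
  basis bounds their number; the contribution of \<open>free s\<close> cancels.\<close>

lemma lead_ord_le: "lead_ord \<le> D.lead_ord"
proof -
  define s where "s = lead_ord + D.lead_ord"
  have up: "ord_le s \<subseteq> acl (ord_le s \<inter> D.par)"
    using D.acl_orderly[OF orderly, of s] by (simp add: ord_le_def)
  have "card (free s \<union> low) \<le> card (ord_le s \<inter> D.par)"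
  proof (rule indep_card_le)
    show "finite (ord_le s \<inter> D.par)" "finite (free s \<union> low)"
      by (simp_all add: finite_ord_le finite_free finite_low)
    have "free s \<union> low \<subseteq> ord_le s" using low_ord_le by (auto simp: free_def ord_le_def s_def)
    then show "free s \<union> low \<subseteq> acl (ord_le s \<inter> D.par)" using up by blast
    show "indep (free s \<union> low)" by (rule indep_subset[OF indep_par]) (simp add: free_par low_par)
  qed
  also have "\<dots> \<le> card (free s) + D.lead_ord" by (rule card_orderly_basis) (simp add: s_def)
  also have "card (free s \<union> low) = card (free s) + lead_ord"
    by (simp add: card_Un_disjoint finite_free finite_low free_low_disjoint card_low)
  finally show ?thesis by simp
qed

text \<open>The key estimate: if \<open>a\<close> is the largest order of a variable \<open>z = (t, a)\<close>, free for
  \<open>C\<close>, in the relations \<open>F u\<close>, then the derivatives of the relation containing \<open>z\<close> allow to exchange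
  \<open>theta m z\<close> for \<open>theta m u\<close>, which has order at most \<open>a\<close> for \<open>m \<le> a - snd u\<close>.
  Counting both sides gives \<open>a + lead_ord \<le> D.lead_ord + snd u\<close>.\<close>

lemma relation_order_le:
  assumes F: "\<And>u. u \<in> leaders \<Longrightarrow> F u \<in> P \<and> u \<in> dvars (F u) \<and> dvars (F u) \<subseteq> insert u par \<and>
      (\<forall>v\<in>dvars (F u). (v, u) \<in> r \<and> pd v (F u) \<notin> P)"
    and w: "u \<in> leaders" "w \<in> dvars (F u)"
  shows "snd w \<le> D.lead_ord"
proof (rule ccontr)
  assume w_large: "\<not> snd w \<le> D.lead_ord"
  define Z where "Z = (\<Union>u\<in>leaders. {v \<in> dvars (F u). fst v \<notin> fst ` leaders})"
  have finZ: "finite Z" by (simp add: Z_def finite_leaders finite_dvars)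
  have lead_le: "snd u \<le> D.lead_ord" if "u \<in> leaders" for u
    using snd_leader_le[OF that] lead_ord_le by simp
  \<comment> \<open>Leaders and \<open>low\<close> have order at most \<open>D.lead_ord\<close>, so
    \<open>w\<close> must belong to an indeterminate without leader.\<close>
  have "w \<in> Z"
  proof -
    have "w \<noteq> u" using lead_le w(1) w_large by blast
    then have "w \<in> par" using F[OF w(1)] w(2) by blast
    moreover have "w \<notin> low" using w_large low_ord_le lead_ord_le by (auto simp: ord_le_def)
    ultimately have "fst w \<notin> fst ` leaders" using par_cases by blast
    then show ?thesis using w unfolding Z_def by blast
  qed
  define a where "a = Max (snd ` Z)"
  have a_ge: "snd v \<le> a" if "v \<in> Z" for v using that finZ by (simp add: a_def)
  have "a \<in> snd ` Z" unfolding a_def using finZ \<open>w \<in> Z\<close> by (intro Max_in) auto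
  then obtain z u0 where z: "u0 \<in> leaders" "z \<in> dvars (F u0)" "fst z \<notin> fst ` leaders" "snd z = a"
    by (auto simp: Z_def)
  have a: "D.lead_ord < a" using a_ge[OF \<open>w \<in> Z\<close>] w_large by simp
  have var_cases: "fst v \<notin> fst ` leaders \<and> snd v \<le> a \<or> v \<in> low \<or> v = u"
    if "u \<in> leaders" "v \<in> dvars (F u)" for u v
    using F[OF that(1)] that par_cases[of v] a_ge[of v] by (auto simp: Z_def)
  \<comment> \<open>Differentiation leaves \<open>low\<close> only at a derivative of a leader, and
    this one takes strictly fewer derivations; the inductions below rest on this.\<close>
  have low_theta: "theta j v \<in> low \<or> (\<exists>u m. u \<in> leaders \<and> m < j \<and> theta j v = theta m u)"
    if v: "v \<in> low" for j v
  proof -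
    obtain u where u: "u \<in> leaders" "fst u = fst v" "snd v < snd u" using v by (auto simp: low_def)
    show ?thesis
    proof (cases "snd v + j < snd u")
      case True
      then show ?thesis using u by (auto simp: low_def theta_def)
    next
      case False
      then have "theta j v = theta (snd v + j - snd u) u" using u by (simp add: theta_def)
      moreover have "snd v + j - snd u < j" using u False by simp
      ultimately show ?thesis using u(1) by blast
    qed
  qed
  have no_deriv: "theta i u \<notin> dvars (F u)" if "u \<in> leaders" "i > 0" for i u
    using F[OF that(1)] theta_not_le[OF that(2)] by blast
  \<comment> \<open>Induction over all leaders at once: the \<open>m\<close>-th derivative of
    \<open>F u\<close> involves free variables up to order \<open>a + m\<close>, variables in
    \<open>low\<close>, and derivatives of leaders with smaller index.\<close>
  have leader_acl: "theta m u \<in> acl (free (a + m) \<union> low)" if "u \<in> leaders" for m u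
    using that
  proof (induction m arbitrary: u rule: less_induct)
    case (less m)
    show ?case
    proof (rule acl_theta)
      show "F u \<in> P" "pd u (F u) \<notin> P" using F[OF less(2)] by blast+
      show "\<And>i. i > 0 \<Longrightarrow> theta i u \<notin> dvars (F u)" using no_deriv[OF less(2)] .
      have IH: "theta j u' \<in> acl (free (a + m) \<union> low)" if "j < m" "u' \<in> leaders" for j u'
        by (rule acl_mono[OF less(1)[OF that]]) (use that in \<open>auto simp: free_def\<close>)
      fix j v assume jv: "j \<le> m" "v \<in> dvars (F u)" "theta j v \<noteq> theta m u"
      consider "fst v \<notin> fst ` leaders" "snd v \<le> a" | "v \<in> low" | "v = u"
        using var_cases[OF less(2) jv(2)] by blast
      then show "theta j v \<in> acl (free (a + m) \<union> low)"
      proof cases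
        case 1
        then show ?thesis using jv(1) by (intro acl.base) (auto simp: free_def theta_def)
      next
        case 2
        from low_theta[OF this, of j] consider "theta j v \<in> low"
          | u' i where "u' \<in> leaders" "i < j" "theta j v = theta i u'" by blast
        then show ?thesis
        proof cases
          case 1
          then show ?thesis by (intro acl.base) blast
        next
          case (2 u' i)
          then show ?thesis using IH[of i u'] jv(1) by simp
        qed
      next
        case 3
        then show ?thesis using jv IH[OF _ less(2), of j] by (cases "j = m") auto
      qed
    qed
  qed
  \<comment> \<open>\<open>theta m u0\<close> has order at most \<open>a\<close> exactly for
    \<open>m \<le> k\<close>.\<close>
  define k where "k = a - snd u0"
  have k: "snd u0 + k = a" using lead_le[OF z(1)] a by (simp add: k_def)
  \<comment> \<open>A basis for order at most \<open>a\<close>, extended by the orders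
    \<open>a + 1\<close> to \<open>a + k\<close> of the free indeterminates except that of
    \<open>z\<close>, whose \<open>k\<close> missing derivatives are recovered next.\<close>
  define B where "B = (ord_le a \<inter> D.par) \<union> (- fst ` leaders - {fst z}) \<times> {a<..a + k}"
  have up: "ord_le a \<subseteq> acl B"
    using D.acl_orderly[OF orderly, of a] acl_mono[of _ "ord_le a \<inter> D.par" B]
    by (auto simp: ord_le_def B_def)
  have lowB: "low \<subseteq> acl B"
  proof -
    have "ord_le lead_ord \<subseteq> ord_le a" using lead_ord_le a by (auto simp: ord_le_def)
    then show ?thesis using up low_ord_le by blast
  qed
  \<comment> \<open>\<open>F u0\<close> is now solved for \<open>z\<close> instead of its leader. By
    maximality of \<open>a\<close> it contains no proper derivative of \<open>z\<close>.\<close>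
  have z_acl: "theta m z \<in> acl B" if "m \<le> k" for m
    using that
  proof (induction m rule: less_induct)
    case (less m)
    have free_acl: "v \<in> acl B" if "fst v \<notin> fst ` leaders" "snd v \<le> a + m" "v \<noteq> theta m z" for v
    proof -
      consider "snd v \<le> a" | "snd v > a" "fst v \<noteq> fst z" | "snd v > a" "fst v = fst z" by linarith
      then show ?thesis
      proof cases
        case 1
        then show ?thesis using up by (auto simp: ord_le_def)
      next
        case 2
        then show ?thesis using that less(2) by (intro acl.base) (auto simp: B_def mem_Times_iff)
      next
        case 3
        then obtain i where i: "v = theta i z" using theta_of_fst_eq[of z v] z(4) by fastforce
        then have "i < m" using that(2,3) z(4) by (cases "i = m") auto
        then show ?thesis unfolding i using less by simp
      qed
    qed
    show ?case
    proof (rule acl_theta)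
      show "F u0 \<in> P" "pd z (F u0) \<notin> P" using F[OF z(1)] z(2) by blast+
      show "theta i z \<notin> dvars (F u0)" if "i > 0" for i
      proof
        assume "theta i z \<in> dvars (F u0)"
        then have "theta i z \<in> Z" using z by (auto simp: Z_def)
        from a_ge[OF this] show False using z(4) that by simp
      qed
      fix j v assume jv: "j \<le> m" "v \<in> dvars (F u0)" "theta j v \<noteq> theta m z"
      consider "fst v \<notin> fst ` leaders" "snd v \<le> a" | "v \<in> low" | "v = u0"
        using var_cases[OF z(1) jv(2)] by blast
      then show "theta j v \<in> acl B"
      proof cases
        case 1
        then show ?thesis using jv by (intro free_acl) auto
      next
        case 2
        from low_theta[OF this, of j] consider "theta j v \<in> low"
          | u i where "u \<in> leaders" "i < j" "theta j v = theta i u" by blast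
        then show ?thesis
        proof cases
          case 1
          then show ?thesis using lowB by blast
        next
          case (2 u i)
          \<comment> \<open>As \<open>i < m\<close>, only free variables of order below
            \<open>a + m\<close> are involved, hence not \<open>theta m z\<close> itself.\<close>
          have "free (a + i) \<subseteq> acl B"
          proof
            fix v assume "v \<in> free (a + i)"
            then have "fst v \<notin> fst ` leaders" "snd v < a + m"
              using 2(2) jv(1) by (simp_all add: free_def mem_Times_iff)
            then show "v \<in> acl B" using z(4) by (intro free_acl) auto
          qed
          then have "theta i u \<in> acl B" using leader_acl[OF 2(1), of i] lowB by (blast intro: acl_idem)
          then show ?thesis using 2(3) by simp
        qed
      next
        case 3
        then have "theta j v \<in> ord_le a" using jv(1) less(2) k by (simp add: ord_le_def)
        then show ?thesis using up by blast
      qed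
    qed
  qed
  have finB: "finite B" by (simp add: B_def finite_ord_le)
  have "card (free (a + k) \<union> low) \<le> card B"
  proof (rule indep_card_le[OF finB])
    show "finite (free (a + k) \<union> low)" by (simp add: finite_free finite_low)
    show "indep (free (a + k) \<union> low)"
      by (rule indep_subset[OF indep_par]) (simp add: free_par low_par)
    have "v \<in> acl B" if v: "v \<in> free (a + k)" for v
    proof -
      consider "snd v \<le> a" | "snd v > a" "fst v \<noteq> fst z" | "snd v > a" "fst v = fst z" by linarith
      then show ?thesis
      proof cases
        case 1
        then show ?thesis using up by (auto simp: ord_le_def)
      next
        case 2
        then show ?thesis using v by (intro acl.base) (auto simp: B_def free_def)
      next
        case 3
        then obtain i where i: "v = theta i z" using theta_of_fst_eq[of z v] z(4) by fastforce
        moreover have "snd v \<le> a + k" using v by (simp add: free_def mem_Times_iff)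
        ultimately have "i \<le> k" using z(4) by simp
        then show ?thesis unfolding i by (rule z_acl)
      qed
    qed
    then show "free (a + k) \<union> low \<subseteq> acl B" using lowB by blast
  qed
  moreover have "card (free (a + k) \<union> low) = card (- fst ` leaders) * (a + k + 1) + lead_ord"
    by (simp add: card_Un_disjoint finite_free finite_low free_low_disjoint card_low)
      (simp add: free_def card_cartesian_product)
  moreover have "card B \<le> card (ord_le a \<inter> D.par) + (card (- fst ` leaders) - 1) * k"
    unfolding B_def using card_Un_le[of "ord_le a \<inter> D.par" "(- fst ` leaders - {fst z}) \<times> {a<..a + k}"] z(3)
    by (simp add: card_cartesian_product)
  moreover have "card (ord_le a \<inter> D.par) \<le> card (- fst ` leaders) * (a + 1) + D.lead_ord"
    using card_orderly_basis[of a] a by (simp add: free_def card_cartesian_product)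
  moreover have "card (- fst ` leaders) = Suc (card (- fst ` leaders) - 1)"
    using z(3) card_gt_0_iff[of "- fst ` leaders"] by auto
  \<comment> \<open>With \<open>q\<close> free indeterminates the counts give \<open>q * (a + k + 1)
    + lead_ord \<le> q * (a + 1) + D.lead_ord + (q - 1) * k\<close>. Since
    \<open>snd u0 \<le> lead_ord\<close>, this yields \<open>a \<le> D.lead_ord\<close>, a
    contradiction.\<close>
  ultimately have "k + lead_ord \<le> D.lead_ord"
    by (cases "card (- fst ` leaders)") (auto simp: algebra_simps)
  then show False using k a snd_leader_le[OF z(1)] by simp
qed

section \<open>Characteristic sets of bounded order\<close>

lemma low_order_relation:
  assumes "u \<in> leaders"
  shows "\<exists>f\<in>P. pd u f \<notin> P \<and> dvars f \<subseteq> insert u (par \<inter> ord_le D.lead_ord)"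
proof -
  let ?R = "\<lambda>u f. f \<in> P \<and> u \<in> dvars f \<and> dvars f \<subseteq> insert u par \<and>
      (\<forall>v\<in>dvars f. (v, u) \<in> r \<and> pd v f \<notin> P)"
  have "\<exists>F. \<forall>u\<in>leaders. ?R u (F u)" using leader_relation by (intro bchoice) blast
  then obtain F where F: "\<And>u. u \<in> leaders \<Longrightarrow> ?R u (F u)" by blast
  have "snd w \<le> D.lead_ord" if "w \<in> dvars (F u)" for w using relation_order_le[OF F assms that] .
  then show ?thesis using F[OF assms] by (intro bexI[of _ "F u"]) (auto simp: ord_le_def)
qed

text \<open>All leaders are algebraic over parametric variables of order at most
  \<open>D.lead_ord\<close>, hence over \<open>par - {x}\<close>. A coefficient outside
  \<open>P\<close> would make \<open>x\<close> algebraic over this set too, against the independence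
  of \<open>par\<close>.\<close>

lemma coef_high:
  assumes x: "x \<in> dvars f" "snd x > D.lead_ord" and f: "f \<in> P" "dvars f \<subseteq> par \<union> leaders"
  shows "coef x j f \<in> P"
proof (rule ccontr)
  assume j: "coef x j f \<notin> P"
  have xl: "x \<notin> leaders" using x snd_leader_le lead_ord_le by fastforce
  have l: "leaders \<subseteq> acl (par - {x})"
  proof
    fix u assume "u \<in> leaders"
    then obtain g where g: "g \<in> P" "pd u g \<notin> P" "dvars g \<subseteq> insert u (par \<inter> ord_le D.lead_ord)"
      using low_order_relation by blast
    have "par \<inter> ord_le D.lead_ord \<subseteq> acl (par - {x})" using x by (auto simp: ord_le_def intro: acl.base)
    then show "u \<in> acl (par - {x})" using g by (intro aclI_pd[OF g(1) _ g(2)]) blast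
  qed
  have "par - {x} \<subseteq> acl (par - {x})" by (auto intro: acl.base)
  then have "dvars f \<subseteq> insert x (acl (par - {x}))" using f(2) l by blast
  from aclI_coef[OF f(1) this j] have "x \<in> acl (par - {x})" .
  moreover have "x \<in> par" using x(1) xl f(2) by blast
  ultimately show False using indep_not_acl[OF indep_par] by blast
qed

text \<open>Pass to a coefficient in one high variable at a time, chosen to keep the degree in
  \<open>u\<close>. \<open>coef_high\<close> keeps it in \<open>P\<close>, and fewer high variables
  remain.\<close>

lemma lower_order:
  assumes g: "g \<in> P" "g \<noteq> 0" "dvars g \<subseteq> par \<union> leaders" and u: "snd u \<le> D.lead_ord"
  shows "\<exists>g'\<in>P. g' \<noteq> 0 \<and> dvars g' \<subseteq> dvars g \<inter> ord_le D.lead_ord \<and> (\<forall>v. deg_in v g' \<le> deg_in v g) \<and>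
    deg_in u g' = deg_in u g"
  using g
proof (induction "card (dvars g - ord_le D.lead_ord)" arbitrary: g rule: less_induct)
  case less
  show ?case
  proof (cases "dvars g \<subseteq> ord_le D.lead_ord")
    case True
    then show ?thesis using less(2,3) by blast
  next
    case False
    then obtain x where "x \<in> dvars g" "x \<notin> ord_le D.lead_ord" by blast
    then have x: "x \<in> dvars g" "snd x > D.lead_ord" by (simp_all add: ord_le_def)
    then have "u \<noteq> x" using u by auto
    then obtain j where j: "deg_in u (coef x j g) = deg_in u g" "coef x j g \<noteq> 0"
      using coef_deg_in_attained[OF less(3), of u x] by blast
    let ?c = "coef x j g"
    have d: "dvars ?c \<subseteq> dvars g - {x}" by (rule dvars_coef)
    have "card (dvars ?c - ord_le D.lead_ord) < card (dvars g - ord_le D.lead_ord)"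
      using d x finite_dvars by (intro psubset_card_mono) (auto simp: ord_le_def)
    from less(1)[OF this] obtain g' where g': "g' \<in> P" "g' \<noteq> 0" "dvars g' \<subseteq> dvars ?c \<inter> ord_le D.lead_ord"
      "\<forall>v. deg_in v g' \<le> deg_in v ?c" "deg_in u g' = deg_in u ?c"
      using coef_high[OF x less(2,4)] j(2) d less(4) by blast
    have "\<forall>v. deg_in v g' \<le> deg_in v g" using g'(4) deg_in_coef[of _ x j g] order_trans by blast
    moreover have "dvars g' \<subseteq> dvars g \<inter> ord_le D.lead_ord" using g'(3) d by blast
    moreover have "deg_in u g' = deg_in u g" using g'(5) j(1) by simp
    ultimately show ?thesis using g'(1,2) by blast
  qed
qed

text \<open>Proper derivatives of the own leader are excluded by the ranking, those of other leaders
  by autoreducedness.\<close>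

lemma dvars_C:
  assumes "g \<in> set C"
  shows "dvars g \<subseteq> par \<union> leaders"
proof
  fix v assume v: "v \<in> dvars g"
  show "v \<in> par \<union> leaders"
  proof (rule ccontr)
    assume *: "v \<notin> par \<union> leaders"
    then obtain m g' where g': "g' \<in> set C" "v = theta m (leader r g')" by (auto simp: par_def leaders_def)
    have "m > 0" using * g' by (cases "m = 0") (auto simp: leaders_def)
    have "g \<noteq> g'" using theta_leader_notin[OF C_not_const[OF assms] \<open>m > 0\<close>] g'(2) v by blast
    then have "reduced_wrt r g g'" using C_autoreduced(2) assms g'(1) by (auto simp: autoreduced_def)
    then show False using \<open>m > 0\<close> v g'(2) by (auto simp: reduced_wrt_def)
  qed
qed

text \<open>Apply \<open>lower_order\<close> to each element with \<open>u\<close> its leader. No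
  variable is added, no degree rises and the degree in the leader stays, so ranks and reducedness
  survive.\<close>

lemma ex_low_order_charset: "\<exists>C'. characteristic_set r P C' \<and> (\<forall>g\<in>set C'. dvars g \<subseteq> ord_le D.lead_ord)"
proof -
  let ?R = "\<lambda>g g'. g' \<in> P \<and> g' \<noteq> 0 \<and> dvars g' \<subseteq> dvars g \<inter> ord_le D.lead_ord \<and>
    (\<forall>v. deg_in v g' \<le> deg_in v g) \<and> deg_in (leader r g) g' = deg_in (leader r g) g"
  have "\<exists>\<phi>. \<forall>g\<in>set C. ?R g (\<phi> g)"
  proof (rule bchoice, rule ballI)
    fix g assume g: "g \<in> set C"
    have "leader r g \<in> leaders" using g by (simp add: leaders_def)
    then have "snd (leader r g) \<le> D.lead_ord" using snd_leader_le lead_ord_le order_trans by blast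
    moreover have "g \<noteq> 0" using C_not_const[OF g] by (metis rangeI single_zero)
    ultimately show "\<exists>g'. ?R g g'" using lower_order[of g "leader r g"] g C_autoreduced(3) dvars_C by blast
  qed
  then obtain \<phi> where \<phi>: "\<And>g. g \<in> set C \<Longrightarrow> ?R g (\<phi> g)" by blast
  have leader: "leader r (\<phi> g) = leader r g" if g: "g \<in> set C" for g
  proof (rule leader_eqI)
    have nc: "g \<notin> range dconst" using g by (rule C_not_const)
    have "deg_in (leader r g) (\<phi> g) > 0" using \<phi>[OF g] leader_in[OF nc] deg_in_pos_iff by metis
    then show "leader r g \<in> dvars (\<phi> g)" by (simp add: deg_in_pos_iff)
    show "\<And>v. v \<in> dvars (\<phi> g) \<Longrightarrow> (v, leader r g) \<in> r" using \<phi>[OF g] leader_ge[OF nc] by blast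
  qed
  have rank: "rank r (\<phi> g) = rank r g" if "g \<in> set C" for g
    using \<phi>[OF that] leader[OF that] by (simp add: rank_def)
  have red: "reduced_wrt r (\<phi> f) (\<phi> g)" if "f \<in> set C" "g \<in> set C" "f \<noteq> g" for f g
  proof -
    have "reduced_wrt r f g" using that C_autoreduced(2) by (auto simp: autoreduced_def)
    then have "reduced_wrt r (\<phi> f) g"
      unfolding reduced_wrt_def using \<phi>[OF that(1)] by (meson IntD1 le_less_trans subsetD)
    then show ?thesis using reduced_wrt_cong[OF rank[OF that(2)]] by simp
  qed
  have "autoreduced r (\<phi> ` set C)"
    unfolding autoreduced_def using red \<phi> P_not_const by blast
  moreover have "sorted_wrt (\<lambda>f g. rank_less r (rank r f) (rank r g)) (map \<phi> C)"
    using C_autoreduced(1) rank unfolding autoreduced_seq_def sorted_wrt_map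
    by (auto intro: sorted_wrt_mono_rel[rotated])
  ultimately have "autoreduced_seq r (map \<phi> C)" by (simp add: autoreduced_seq_def)
  then have "characteristic_set r P (map \<phi> C)"
    by (rule characteristic_set_same_ranks[OF charset]) (use \<phi> rank in auto)
  moreover have "\<forall>g\<in>set (map \<phi> C). dvars g \<subseteq> ord_le D.lead_ord" using \<phi> by auto
  ultimately show ?thesis by blast
qed

end

theorem theorem6:
  fixes \<delta> :: "'k::field_char_0 \<Rightarrow> 'k"
    and P :: "('n::finite, 'k) dpoly set"
    and h :: nat
    and r :: "'n dvar rel"
  assumes "derivation \<delta>"
    and "prime_diff_ideal \<delta> P"
    and "has_order P h"
    and "ranking r"
  shows "\<exists>C. characteristic_set r P C \<and>
    (\<forall>i<length C. \<forall>t. (\<exists>j. (t, j) \<in> dvars (C ! i)) \<longrightarrow> dord_in t (C ! i) \<le> h)"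
proof -
  obtain r' D where D: "ranking r'" "orderly r'" "characteristic_set r' P D" "h = (\<Sum>f\<leftarrow>D. dord f)"
    using assms(3) unfolding has_order_def by blast
  interpret dranking r by unfold_locales fact
  obtain C0 where C0: "characteristic_set r P C0" using ex_characteristic_set by blast
  interpret charset_pair \<delta> P r r' C0 D
    by unfold_locales fact+
  obtain C where C: "characteristic_set r P C" "\<forall>g\<in>set C. dvars g \<subseteq> ord_le D.lead_ord"
    using ex_low_order_charset by blast
  have h: "D.lead_ord = h" using D.lead_ord_orderly[OF D(2)] D(4) by simp
  have "dord_in t (C ! i) \<le> h" if "i < length C" "(t, j) \<in> dvars (C ! i)" for i t j
  proof -
    have "dvars (C ! i) \<subseteq> ord_le h" using C(2) that(1) h by simp
    then have "{j. (t, j) \<in> dvars (C ! i)} \<subseteq> {..h}" by (auto simp: ord_le_def)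
    \<comment> \<open>The witness \<open>(t, j)\<close> makes the set nonempty, so its maximum is a
      genuine order.\<close>
    then show ?thesis
      unfolding dord_in_def using that(2) by (subst Max_le_iff) (auto intro: finite_subset)
  qed
  then show ?thesis using C(1) by blast
qed

end
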